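(* Let $x$ be an arbitrary element of $B_\bullet$. Then the closure of $\{x\}$ under the bracket operation $u,v\mapsto u\lceil v\rceil$ is a free LD-system (of rank one, generated by $x$).
   Context: $B_\bullet$ is the group (of parenthesized braids) presented by generators $\sigma_i,a_i$ ($i\ge1$) and the relations, for all $i\ge1$ and $j\ge i+2$: $\sigma_i\sigma_j=\sigma_j\sigma_i$, $\sigma_ia_j=a_j\sigma_i$, $a_ia_{j-1}=a_ja_i$, $a_i\sigma_{j-1}=\sigma_ja_i$, $\sigma_i\sigma_{i+1}\sigma_i=\sigma_{i+1}\sigma_i\sigma_{i+1}$, $\sigma_{i+1}\sigma_ia_{i+1}=a_i\sigma_i$, $\sigma_i\sigma_{i+1}a_i=a_{i+1}\sigma_i$. The map $\partial$ is the injective endomorphism of $B_\bullet$ with $\sigma_i\mapsto\sigma_{i+1}$, $a_i\mapsto a_{i+1}$. The bracket is $u\lceil v\rceil=u\cdot\partial v\cdot\sigma_1\cdot(\partial u)^{-1}$. An LD-system is a set with a binary operation satisfying the left self-distributivity law $u\lceil v\lceil w\rceil\rceil=(u\lceil v\rceil)\lceil u\lceil w\rceil\rceil$; $B_\bullet$ with its bracket is one. Free means free in the variety of LD-systems. *)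

theory Defs
  imports "HOL-Algebra.Group"
begin

section \<open>Groups presented by generators and relations\<close>

text \<open>A word is a list of signed generators: \<open>(g, True)\<close> stands for \<open>g\<close> and
  \<open>(g, False)\<close> for its inverse.\<close>

type_synonym 'g word = "('g \<times> bool) list"

definition words :: "'g set \<Rightarrow> 'g word set" where
  "words X = lists (X \<times> UNIV)"

inductive_set presented_cong :: "'g set \<Rightarrow> ('g word \<times> 'g word) set \<Rightarrow> ('g word \<times> 'g word) set"
  for X R where
  rel: "(u, v) \<in> R \<Longrightarrow> (u, v) \<in> presented_cong X R"
| cancel: "g \<in> X \<Longrightarrow> ([(g, b), (g, \<not> b)], []) \<in> presented_cong X R"
| refl: "w \<in> words X \<Longrightarrow> (w, w) \<in> presented_cong X R"
| sym: "(u, v) \<in> presented_cong X R \<Longrightarrow> (v, u) \<in> presented_cong X R"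
| trans: "(u, v) \<in> presented_cong X R \<Longrightarrow> (v, w) \<in> presented_cong X R
    \<Longrightarrow> (u, w) \<in> presented_cong X R"
| append: "(u, u') \<in> presented_cong X R \<Longrightarrow> (v, v') \<in> presented_cong X R
    \<Longrightarrow> (u @ v, u' @ v') \<in> presented_cong X R"

definition presented_group :: "'g set \<Rightarrow> ('g word \<times> 'g word) set \<Rightarrow> 'g word set monoid" where
  "presented_group X R =
     \<lparr>carrier = words X // presented_cong X R,
      mult = (\<lambda>A B. \<Union>u\<in>A. \<Union>v\<in>B. presented_cong X R `` {u @ v}),
      one = presented_cong X R `` {[]}\<rparr>"

lemma presented_cong_words:
  assumes "R \<subseteq> words X \<times> words X" and "(u, v) \<in> presented_cong X R"
  shows "u \<in> words X \<and> v \<in> words X"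
  using assms(2) by induction (use assms(1) in \<open>auto simp: words_def\<close>)

lemma equiv_presented_cong:
  assumes "R \<subseteq> words X \<times> words X"
  shows "equiv (words X) (presented_cong X R)"
proof (rule equivI)
  show "presented_cong X R \<subseteq> words X \<times> words X"
    using presented_cong_words[OF assms] by auto
  show "refl_on (words X) (presented_cong X R)"
    by (auto intro: refl_onI presented_cong.refl)
  show "sym (presented_cong X R)"
    by (auto intro: symI presented_cong.sym)
  show "trans (presented_cong X R)"
    by (blast intro: transI presented_cong.trans)
qed

lemma mult_presented_group:
  assumes R: "R \<subseteq> words X \<times> words X" and "u \<in> words X" "v \<in> words X"
  shows "presented_cong X R `` {u} \<otimes>\<^bsub>presented_group X R\<^esub> presented_cong X R `` {v}
       = presented_cong X R `` {u @ v}"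
proof -
  have "congruent2 (presented_cong X R) (presented_cong X R)
          (\<lambda>u v. presented_cong X R `` {u @ v})"
    by (auto intro!: congruent2I' equiv_class_eq[OF equiv_presented_cong[OF R]]
        intro: presented_cong.append)
  from UN_equiv_class2[OF equiv_presented_cong[OF R] equiv_presented_cong[OF R] this assms(2,3)]
  show ?thesis by (simp add: presented_group_def)
qed

lemma presented_cong_inverse:
  assumes "w \<in> words X"
  shows "(map (\<lambda>(g, b). (g, \<not> b)) (rev w) @ w, []) \<in> presented_cong X R"
  using assms
proof (induction w)
  case Nil
  then show ?case by (auto intro: presented_cong.refl)
next
  case (Cons p w)
  obtain g b where p: "p = (g, b)" by (cases p)
  let ?i = "map (\<lambda>(g, b). (g, \<not> b)) (rev w)"
  have g: "g \<in> X" and w: "w \<in> words X" and i: "?i \<in> words X"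
    using Cons.prems p by (auto simp: words_def)
  have "([(g, \<not> b), (g, b)] @ w, [] @ w) \<in> presented_cong X R"
    using presented_cong.append[OF presented_cong.cancel[OF g, of "\<not> b"]
        presented_cong.refl[OF w]] by simp
  with i have "(?i @ [(g, \<not> b), (g, b)] @ w, ?i @ [] @ w) \<in> presented_cong X R"
    by (blast intro: presented_cong.append[OF presented_cong.refl])
  moreover have "(?i @ w, []) \<in> presented_cong X R" using Cons.IH w by blast
  ultimately show ?case using p by (auto intro: presented_cong.trans)
qed

lemma group_presented_group:
  assumes R: "R \<subseteq> words X \<times> words X"
  shows "group (presented_group X R)"
proof (rule groupI)
  let ?G = "presented_group X R" and ?c = "\<lambda>w. presented_cong X R `` {w}"
  have car: "carrier ?G = ?c ` words X"
    by (auto simp: presented_group_def quotient_def)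
  have one: "\<one>\<^bsub>?G\<^esub> = ?c []" by (simp add: presented_group_def)
  note m = mult_presented_group[OF R]
  have app: "u @ v \<in> words X" if "u \<in> words X" "v \<in> words X" for u v
    using that by (simp add: words_def)
  have nil: "[] \<in> words X" by (simp add: words_def)
  show "\<one>\<^bsub>?G\<^esub> \<in> carrier ?G" using nil by (auto simp: car one)
  fix x assume x: "x \<in> carrier ?G"
  show "\<one>\<^bsub>?G\<^esub> \<otimes>\<^bsub>?G\<^esub> x = x" using x nil by (auto simp: car one m)
  show "\<exists>y\<in>carrier ?G. y \<otimes>\<^bsub>?G\<^esub> x = \<one>\<^bsub>?G\<^esub>"
  proof -
    obtain w where w: "w \<in> words X" "x = ?c w" using x by (auto simp: car)
    let ?i = "map (\<lambda>(g, b). (g, \<not> b)) (rev w)"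
    have i: "?i \<in> words X" using w(1) by (auto simp: words_def)
    have "?c ?i \<otimes>\<^bsub>?G\<^esub> x = \<one>\<^bsub>?G\<^esub>"
      using equiv_class_eq[OF equiv_presented_cong[OF R] presented_cong_inverse[OF w(1)]]
      by (simp add: w(2) m[OF i w(1)] one)
    then show ?thesis using i by (auto simp: car)
  qed
  fix y assume y: "y \<in> carrier ?G"
  show "x \<otimes>\<^bsub>?G\<^esub> y \<in> carrier ?G" using x y app by (auto simp: car m)
  fix z assume z: "z \<in> carrier ?G"
  show "x \<otimes>\<^bsub>?G\<^esub> y \<otimes>\<^bsub>?G\<^esub> z = x \<otimes>\<^bsub>?G\<^esub> (y \<otimes>\<^bsub>?G\<^esub> z)"
    using x y z app by (auto simp: car m)
qed

section \<open>The group of parenthesized braids\<close>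

datatype pbgen = Sig nat | Al nat

abbreviation \<sigma> :: "nat \<Rightarrow> pbgen \<times> bool" where "\<sigma> i \<equiv> (Sig i, True)"
abbreviation \<a> :: "nat \<Rightarrow> pbgen \<times> bool" where "\<a> i \<equiv> (Al i, True)"

definition pbgens :: "pbgen set" where
  "pbgens = Sig ` {1..} \<union> Al ` {1..}"

definition pbrels :: "(pbgen word \<times> pbgen word) set" where
  "pbrels =
     {([\<sigma> i, \<sigma> j], [\<sigma> j, \<sigma> i]) | i j. 1 \<le> i \<and> i + 2 \<le> j} \<union>
     {([\<sigma> i, \<a> j], [\<a> j, \<sigma> i]) | i j. 1 \<le> i \<and> i + 2 \<le> j} \<union>
     {([\<a> i, \<a> (j - 1)], [\<a> j, \<a> i]) | i j. 1 \<le> i \<and> i + 2 \<le> j} \<union>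
     {([\<a> i, \<sigma> (j - 1)], [\<sigma> j, \<a> i]) | i j. 1 \<le> i \<and> i + 2 \<le> j} \<union>
     {([\<sigma> i, \<sigma> (i + 1), \<sigma> i], [\<sigma> (i + 1), \<sigma> i, \<sigma> (i + 1)]) | i. 1 \<le> i} \<union>
     {([\<sigma> (i + 1), \<sigma> i, \<a> (i + 1)], [\<a> i, \<sigma> i]) | i. 1 \<le> i} \<union>
     {([\<sigma> i, \<sigma> (i + 1), \<a> i], [\<a> (i + 1), \<sigma> i]) | i. 1 \<le> i}"

definition PB :: "pbgen word set monoid"  (\<open>B\<^sub>\<bullet>\<close>) where
  "B\<^sub>\<bullet> = presented_group pbgens pbrels"

definition pbclass :: "pbgen word \<Rightarrow> pbgen word set" where
  "pbclass w = presented_cong pbgens pbrels `` {w}"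

fun shift_gen :: "pbgen \<Rightarrow> pbgen" where
  "shift_gen (Sig i) = Sig (i + 1)"
| "shift_gen (Al i) = Al (i + 1)"

definition shift_word :: "pbgen word \<Rightarrow> pbgen word" where
  "shift_word = map (map_prod shift_gen id)"

definition pbshift :: "pbgen word set \<Rightarrow> pbgen word set"  (\<open>\<partial>\<close>) where
  "\<partial> A = (\<Union>w\<in>A. pbclass (shift_word w))"

definition pb_bracket :: "pbgen word set \<Rightarrow> pbgen word set \<Rightarrow> pbgen word set"  (\<open>_\<lceil>_\<rceil>\<close> [90, 0] 90) where
  "u\<lceil>v\<rceil> = u \<otimes>\<^bsub>B\<^sub>\<bullet>\<^esub> \<partial> v \<otimes>\<^bsub>B\<^sub>\<bullet>\<^esub> pbclass [\<sigma> 1] \<otimes>\<^bsub>B\<^sub>\<bullet>\<^esub> inv\<^bsub>B\<^sub>\<bullet>\<^esub> (\<partial> u)"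

lemma pbrels_words: "pbrels \<subseteq> words pbgens \<times> words pbgens"
  by (auto simp: pbrels_def words_def pbgens_def)

lemma group_PB: "group B\<^sub>\<bullet>"
  unfolding PB_def by (rule group_presented_group[OF pbrels_words])

lemma carrier_PB: "carrier B\<^sub>\<bullet> = pbclass ` words pbgens"
  by (auto simp: PB_def pbclass_def presented_group_def quotient_def)

lemma mult_pbclass:
  "u \<in> words pbgens \<Longrightarrow> v \<in> words pbgens \<Longrightarrow> pbclass u \<otimes>\<^bsub>B\<^sub>\<bullet>\<^esub> pbclass v = pbclass (u @ v)"
  unfolding PB_def pbclass_def by (rule mult_presented_group[OF pbrels_words])

lemma shift_word_words: "w \<in> words pbgens \<Longrightarrow> shift_word w \<in> words pbgens"
  by (fastforce simp: words_def shift_word_def pbgens_def)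

lemma shift_word_rels:
  assumes "(u, v) \<in> pbrels"
  shows "(shift_word u, shift_word v) \<in> pbrels"
proof -
  have *: "\<exists>i' j'. i + 1 = i' \<and> j + 1 = j' \<and> j - 1 + 1 = j' - 1 \<and> 1 \<le> i' \<and> i' + 2 \<le> j'"
    if "1 \<le> i" "i + 2 \<le> j" for i j :: nat using that by auto
  show ?thesis
    using assms unfolding pbrels_def shift_word_def
    by (elim UnE) (force dest: *)+
qed

lemma shift_word_cong:
  assumes "(u, v) \<in> presented_cong pbgens pbrels"
  shows "(shift_word u, shift_word v) \<in> presented_cong pbgens pbrels"
  using assms
proof induction
  case (rel u v)
  then show ?case by (intro presented_cong.rel shift_word_rels)
next
  case (cancel g b)
  then have "shift_gen g \<in> pbgens" by (auto simp: pbgens_def)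
  then show ?case by (auto simp: shift_word_def intro: presented_cong.cancel)
next
  case (append u u' v v')
  then show ?case by (auto simp: shift_word_def intro: presented_cong.append)
qed (auto intro: presented_cong.refl presented_cong.sym presented_cong.trans shift_word_words)

lemma pbshift_pbclass:
  assumes "w \<in> words pbgens"
  shows "\<partial> (pbclass w) = pbclass (shift_word w)"
proof -
  note eq = equiv_presented_cong[OF pbrels_words]
  have "(\<lambda>w. pbclass (shift_word w)) respects presented_cong pbgens pbrels"
    unfolding pbclass_def by (auto intro!: congruentI equiv_class_eq[OF eq] shift_word_cong)
  from UN_equiv_class[OF eq this assms] show ?thesis
    by (simp add: pbshift_def pbclass_def)
qed

lemma pbshift_hom: "\<partial> \<in> hom B\<^sub>\<bullet> B\<^sub>\<bullet>"
proof (rule homI)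
  fix x assume "x \<in> carrier B\<^sub>\<bullet>"
  then show "\<partial> x \<in> carrier B\<^sub>\<bullet>"
    by (auto simp: carrier_PB pbshift_pbclass shift_word_words)
next
  fix x y assume "x \<in> carrier B\<^sub>\<bullet>" "y \<in> carrier B\<^sub>\<bullet>"
  then obtain u v where "u \<in> words pbgens" "v \<in> words pbgens" "x = pbclass u" "y = pbclass v"
    by (auto simp: carrier_PB)
  moreover from this have "u @ v \<in> words pbgens" by (simp add: words_def)
  ultimately show "\<partial> (x \<otimes>\<^bsub>B\<^sub>\<bullet>\<^esub> y) = \<partial> x \<otimes>\<^bsub>B\<^sub>\<bullet>\<^esub> \<partial> y"
    by (simp add: mult_pbclass pbshift_pbclass shift_word_words) (simp add: shift_word_def)
qed

lemma pbshift_generators: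
  assumes "1 \<le> i"
  shows "\<partial> (pbclass [\<sigma> i]) = pbclass [\<sigma> (i + 1)]" "\<partial> (pbclass [\<a> i]) = pbclass [\<a> (i + 1)]"
  using assms by (auto simp: pbshift_pbclass words_def pbgens_def shift_word_def)

section \<open>Free left self-distributive systems\<close>

locale LD_system =
  fixes S :: "'a set" and opn :: "'a \<Rightarrow> 'a \<Rightarrow> 'a"
  assumes closed: "u \<in> S \<Longrightarrow> v \<in> S \<Longrightarrow> opn u v \<in> S"
    and left_distrib: "u \<in> S \<Longrightarrow> v \<in> S \<Longrightarrow> w \<in> S \<Longrightarrow>
          opn u (opn v w) = opn (opn u v) (opn u w)"

definition LD_hom :: "'a set \<Rightarrow> ('a \<Rightarrow> 'a \<Rightarrow> 'a) \<Rightarrow> 'b set \<Rightarrow> ('b \<Rightarrow> 'b \<Rightarrow> 'b) \<Rightarrow> ('a \<Rightarrow> 'b) set" where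
  "LD_hom S opS T opT =
     {h \<in> S \<rightarrow>\<^sub>E T. \<forall>u\<in>S. \<forall>v\<in>S. h (opS u v) = opT (h u) (h v)}"

text \<open>The universal property of the free LD-system with basis \<open>X\<close>. A definition cannot quantify
  over types, so the type \<open>'b\<close> in which the target systems live is a parameter; freeness in the
  variety of all LD-systems is this predicate with \<open>'b\<close> an arbitrary type variable.\<close>

definition free_LD_system ::
    "'b itself \<Rightarrow> 'a set \<Rightarrow> ('a \<Rightarrow> 'a \<Rightarrow> 'a) \<Rightarrow> 'a set \<Rightarrow> bool" where
  "free_LD_system _ S opS X \<longleftrightarrow>
     LD_system S opS \<and> X \<subseteq> S \<and>
     (\<forall>(T :: 'b set) opT f. LD_system T opT \<and> f \<in> X \<rightarrow> T \<longrightarrow>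
        (\<exists>!h. h \<in> LD_hom S opS T opT \<and> (\<forall>x\<in>X. h x = f x)))"

inductive_set op_closure :: "('a \<Rightarrow> 'a \<Rightarrow> 'a) \<Rightarrow> 'a set \<Rightarrow> 'a set"
  for opn X where
  base: "x \<in> X \<Longrightarrow> x \<in> op_closure opn X"
| opn: "u \<in> op_closure opn X \<Longrightarrow> v \<in> op_closure opn X \<Longrightarrow> opn u v \<in> op_closure opn X"

end

theory Submission
  imports Defs
begin

text \<open>By Laver's criterion an LD-system with one generator is free as soon as left division in it
  has no cycle: any two terms in one variable are, up to left self-distributivity, equal or one is
  an iterated left subterm of the other. The latter comparison property follows from confluence of
  LD-expansions, since every term \<open>t\<close> satisfies \<open>t \<cdot> x\<^sup>n = x\<^sup>n\<^sup>+\<^sup>1\<close> for large \<open>n\<close>, where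
  \<open>x\<^sup>n\<^sup>+\<^sup>1 = x \<cdot> x\<^sup>n\<close>, so that any two terms expand to left subterms of a common term.

  A cycle in \<open>B\<^sub>\<bullet>\<close> would give a relation \<open>1 = \<partial> c\<^sub>0 \<sigma>\<^sub>1 \<partial> c\<^sub>1 \<sigma>\<^sub>1 \<dots> \<sigma>\<^sub>1 \<partial> c\<^sub>k\<close> with \<open>k \<ge> 1\<close>. This is
  excluded by extending Artin's action of braids on a free group to \<open>B\<^sub>\<bullet>\<close> and following Larue:
  with \<open>x\<^sub>1\<close> the first loop, elements of the form \<open>\<partial> c\<close> fix the inverse of \<open>x\<^sub>1\<close> and
  preserve the set of reduced words starting with \<open>x\<^sub>1\<close>, while \<open>\<sigma>\<^sub>1\<close> maps both into that set.\<close>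

section \<open>Comparison of terms and freeness of monogenerated LD-systems\<close>

datatype ldterm = Var | App ldterm ldterm (infixl "\<cdot>" 70)

inductive expands1 :: "ldterm \<Rightarrow> ldterm \<Rightarrow> bool" where
  root: "expands1 (s \<cdot> (t \<cdot> r)) ((s \<cdot> t) \<cdot> (s \<cdot> r))"
| left: "expands1 s s' \<Longrightarrow> expands1 (s \<cdot> t) (s' \<cdot> t)"
| right: "expands1 t t' \<Longrightarrow> expands1 (s \<cdot> t) (s \<cdot> t')"

abbreviation expands :: "ldterm \<Rightarrow> ldterm \<Rightarrow> bool" (infix "\<rightarrow>\<^sup>*" 50) where
  "s \<rightarrow>\<^sup>* t \<equiv> expands1\<^sup>*\<^sup>* s t"

lemma expands_trans: "s \<rightarrow>\<^sup>* t \<Longrightarrow> t \<rightarrow>\<^sup>* r \<Longrightarrow> s \<rightarrow>\<^sup>* r"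
  by (rule rtranclp_trans)

lemma expands_root: "s \<cdot> (t \<cdot> r) \<rightarrow>\<^sup>* (s \<cdot> t) \<cdot> (s \<cdot> r)"
  by (rule r_into_rtranclp) (rule expands1.root)

lemma expands_App:
  assumes "s \<rightarrow>\<^sup>* s'" and "t \<rightarrow>\<^sup>* t'"
  shows "s \<cdot> t \<rightarrow>\<^sup>* s' \<cdot> t'"
proof -
  have "s \<cdot> t \<rightarrow>\<^sup>* s' \<cdot> t" using assms(1)
    by (induction rule: rtranclp_induct) (auto intro: rtranclp.rtrancl_into_rtrancl expands1.left)
  also have "s' \<cdot> t \<rightarrow>\<^sup>* s' \<cdot> t'" using assms(2)
    by (induction rule: rtranclp_induct) (auto intro: rtranclp.rtrancl_into_rtrancl expands1.right)
  finally show ?thesis .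
qed

text \<open>The outcome of distributing \<open>s\<close> over every product inside the second
  argument, so that it ends up in front of each leaf.\<close>

primrec distrib :: "ldterm \<Rightarrow> ldterm \<Rightarrow> ldterm" where
  "distrib s Var = s \<cdot> Var"
| "distrib s (t \<cdot> r) = distrib s t \<cdot> distrib s r"

lemma App_expands_distrib: "s \<cdot> t \<rightarrow>\<^sup>* distrib s t"
proof (induction t)
  case (App t r)
  then show ?case using expands_trans[OF expands_root expands_App] by simp
qed simp

lemma distrib_mono_left: "s \<rightarrow>\<^sup>* s' \<Longrightarrow> distrib s t \<rightarrow>\<^sup>* distrib s' t"
  by (induction t) (auto intro: expands_App)

lemma distrib_mono1: "expands1 t t' \<Longrightarrow> distrib s t \<rightarrow>\<^sup>* distrib s t'"
  by (induction rule: expands1.induct) (auto intro: expands_App expands_root)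

lemma distrib_mono_right: "t \<rightarrow>\<^sup>* t' \<Longrightarrow> distrib s t \<rightarrow>\<^sup>* distrib s t'"
  by (induction rule: rtranclp_induct) (auto intro: expands_trans distrib_mono1)

text \<open>Only the leaves matter: there one root expansion, followed by distributing
  \<open>distrib s t\<close> over \<open>s\<close>, leads from one side to the other. This is the
  root case in the monotonicity of \<open>full_expansion\<close>.\<close>

lemma distrib_distrib: "distrib s (distrib t r) \<rightarrow>\<^sup>* distrib (distrib s t) (distrib s r)"
proof (induction r)
  case Var
  have "distrib s t \<cdot> (s \<cdot> Var) \<rightarrow>\<^sup>* (distrib s t \<cdot> s) \<cdot> (distrib s t \<cdot> Var)"
    by (rule expands_root)
  also have "\<dots> \<rightarrow>\<^sup>* distrib (distrib s t) s \<cdot> (distrib s t \<cdot> Var)"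
    by (intro expands_App App_expands_distrib) simp_all
  finally show ?case by simp
qed (simp add: expands_App)

text \<open>An upper bound for all one-step expansions of a term at once. As the operation is also
  monotone, its iterates bound longer expansions.\<close>

primrec full_expansion :: "ldterm \<Rightarrow> ldterm" where
  "full_expansion Var = Var"
| "full_expansion (s \<cdot> t) = distrib (full_expansion s) (full_expansion t)"

lemma expands_full_expansion: "t \<rightarrow>\<^sup>* full_expansion t"
proof (induction t)
  case (App s t)
  then show ?case using expands_trans[OF expands_App App_expands_distrib] by simp
qed simp

lemma expands1_full_expansion: "expands1 t t' \<Longrightarrow> t' \<rightarrow>\<^sup>* full_expansion t"
proof (induction rule: expands1.induct)
  case (root s t r)
  let ?f = full_expansion
  have "?f s \<cdot> ?f t \<rightarrow>\<^sup>* distrib (?f s) (?f t)" "?f s \<cdot> ?f r \<rightarrow>\<^sup>* distrib (?f s) (?f r)"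
    by (rule App_expands_distrib)+
  then have "(s \<cdot> t) \<cdot> (s \<cdot> r) \<rightarrow>\<^sup>* distrib (?f s) (?f t \<cdot> ?f r)"
    by (auto intro!: expands_App intro: expands_trans[OF expands_App] expands_full_expansion)
  also have "\<dots> \<rightarrow>\<^sup>* distrib (?f s) (distrib (?f t) (?f r))"
    by (intro distrib_mono_right App_expands_distrib)
  finally show ?case by simp
qed (auto intro: expands_trans[OF expands_App App_expands_distrib] expands_full_expansion)

lemma full_expansion_mono: "t \<rightarrow>\<^sup>* t' \<Longrightarrow> full_expansion t \<rightarrow>\<^sup>* full_expansion t'"
proof (induction rule: rtranclp_induct)
  case (step t' t'')
  from step(2) have "full_expansion t' \<rightarrow>\<^sup>* full_expansion t''"
    by (induction rule: expands1.induct)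
      (auto intro: distrib_distrib distrib_mono_left distrib_mono_right)
  with step(3) show ?case by (rule expands_trans)
qed simp

text \<open>Each further expansion step costs one more application of \<open>full_expansion\<close>.
  The form with all \<open>m \<ge> n\<close> lets the bounds for two expansions meet in their
  maximum.\<close>

lemma expands_iterate_full_expansion:
  "t \<rightarrow>\<^sup>* t' \<Longrightarrow> \<exists>n. \<forall>m\<ge>n. t' \<rightarrow>\<^sup>* (full_expansion ^^ m) t"
proof (induction rule: rtranclp_induct)
  case base
  have "t \<rightarrow>\<^sup>* (full_expansion ^^ m) t" for m
    by (induction m) (auto intro: expands_trans expands_full_expansion)
  then show ?case by blast
next
  case (step t' t'')
  then obtain n where n: "\<And>m. m \<ge> n \<Longrightarrow> t' \<rightarrow>\<^sup>* (full_expansion ^^ m) t" by blast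
  have "t'' \<rightarrow>\<^sup>* (full_expansion ^^ m) t" if m: "m \<ge> Suc n" for m
  proof -
    obtain k where k: "m = Suc k" "k \<ge> n" using m by (cases m) auto
    have "t'' \<rightarrow>\<^sup>* full_expansion t'" by (rule expands1_full_expansion[OF step(2)])
    also have "\<dots> \<rightarrow>\<^sup>* full_expansion ((full_expansion ^^ k) t)"
      by (rule full_expansion_mono[OF n[OF k(2)]])
    finally show ?thesis by (simp add: k)
  qed
  then show ?case by blast
qed

lemma expands_confluent:
  assumes "t \<rightarrow>\<^sup>* t1" and "t \<rightarrow>\<^sup>* t2"
  shows "\<exists>r. t1 \<rightarrow>\<^sup>* r \<and> t2 \<rightarrow>\<^sup>* r"
proof -
  obtain n1 n2 where "\<forall>m\<ge>n1. t1 \<rightarrow>\<^sup>* (full_expansion ^^ m) t" "\<forall>m\<ge>n2. t2 \<rightarrow>\<^sup>* (full_expansion ^^ m) t"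
    using assms expands_iterate_full_expansion by meson
  then show ?thesis by (meson max.cobounded1 max.cobounded2)
qed

text \<open>By confluence, having a common expansion is the congruence generated by the left
  self-distributivity law.\<close>

definition LD_equiv :: "ldterm \<Rightarrow> ldterm \<Rightarrow> bool" (infix "\<simeq>" 50) where
  "s \<simeq> t \<longleftrightarrow> (\<exists>r. s \<rightarrow>\<^sup>* r \<and> t \<rightarrow>\<^sup>* r)"

lemma LD_equiv_refl [simp]: "t \<simeq> t"
  by (auto simp: LD_equiv_def)

lemma LD_equiv_sym: "s \<simeq> t \<Longrightarrow> t \<simeq> s"
  by (auto simp: LD_equiv_def)

lemma LD_equiv_trans [trans]: "s \<simeq> t \<Longrightarrow> t \<simeq> r \<Longrightarrow> s \<simeq> r"
  unfolding LD_equiv_def by (meson expands_confluent expands_trans)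

lemma LD_equiv_App: "s \<simeq> s' \<Longrightarrow> t \<simeq> t' \<Longrightarrow> s \<cdot> t \<simeq> s' \<cdot> t'"
  unfolding LD_equiv_def by (meson expands_App)

lemma LD_equiv_distrib: "s \<cdot> (t \<cdot> r) \<simeq> (s \<cdot> t) \<cdot> (s \<cdot> r)"
  unfolding LD_equiv_def using expands_root by blast

section \<open>Comparison of terms by iterated left subterms\<close>

primrec right_power :: "nat \<Rightarrow> ldterm" where
  "right_power 0 = Var"
| "right_power (Suc n) = Var \<cdot> right_power n"

text \<open>Writing the power as \<open>s \<cdot> p\<close>, self-distributivity turns
  \<open>(s \<cdot> t) \<cdot> (s \<cdot> p)\<close> into \<open>s \<cdot> (t \<cdot> p)\<close>, so
  that absorption by \<open>s\<close> and by \<open>t\<close> gives absorption by their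
  product.\<close>

lemma right_power_absorbs: "\<exists>m. \<forall>n\<ge>m. t \<cdot> right_power n \<simeq> right_power (Suc n)"
proof (induction t)
  case Var
  then show ?case by simp
next
  case (App s t)
  then obtain k l where k: "\<And>n. n \<ge> k \<Longrightarrow> s \<cdot> right_power n \<simeq> right_power (Suc n)"
    and l: "\<And>n. n \<ge> l \<Longrightarrow> t \<cdot> right_power n \<simeq> right_power (Suc n)" by blast
  \<comment> \<open>The extra \<open>Suc\<close> keeps the exponent \<open>m\<close> of the power
    inside \<open>s \<cdot> right_power m\<close> above both bounds.\<close>
  have "(s \<cdot> t) \<cdot> right_power n \<simeq> right_power (Suc n)" if n: "n \<ge> Suc (max k l)" for n
  proof -
    obtain m where m: "n = Suc m" "m \<ge> k" "m \<ge> l" using n by (cases n) auto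
    have "(s \<cdot> t) \<cdot> right_power n \<simeq> (s \<cdot> t) \<cdot> (s \<cdot> right_power m)"
      unfolding m(1) by (intro LD_equiv_App LD_equiv_refl LD_equiv_sym[OF k] m)
    also have "\<dots> \<simeq> s \<cdot> (t \<cdot> right_power m)" by (rule LD_equiv_sym[OF LD_equiv_distrib])
    also have "\<dots> \<simeq> s \<cdot> right_power n"
      unfolding m(1) by (intro LD_equiv_App LD_equiv_refl l m)
    also have "\<dots> \<simeq> right_power (Suc n)" using m by (intro k) simp
    finally show ?thesis .
  qed
  then show ?case by blast
qed

inductive left_subterm :: "ldterm \<Rightarrow> ldterm \<Rightarrow> bool" (infix "\<prec>" 50) where
  left: "s \<prec> s \<cdot> t"
| left_left: "r \<prec> s \<Longrightarrow> r \<prec> s \<cdot> t"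

inductive_cases left_subtermE: "r \<prec> s \<cdot> t"

text \<open>A root expansion of \<open>p \<cdot> (q \<cdot> r)\<close> keeps \<open>p\<close> on the
  leftmost branch and only inserts \<open>p \<cdot> q\<close> above it. An expansion inside the left
  factor at most expands the subterm, and one inside the right factor leaves the branch below the
  root alone.\<close>

lemma left_subterm_expands1:
  "expands1 t t' \<Longrightarrow> s \<prec> t \<Longrightarrow> \<exists>s'. s \<rightarrow>\<^sup>* s' \<and> s' \<prec> t'"
proof (induction arbitrary: s rule: expands1.induct)
  case (root p q r)
  then show ?case
    by (auto elim!: left_subtermE intro: left_subterm.intros)
next
  case (left p p' q)
  from left(3) show ?case
    by (rule left_subtermE) (use left in \<open>blast intro: left_subterm.intros\<close>)+
next
  case (right q q' p)
  then show ?case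
    by (auto elim!: left_subtermE intro: left_subterm.intros)
qed

lemma left_subterm_expands:
  "t \<rightarrow>\<^sup>* t' \<Longrightarrow> s \<prec> t \<Longrightarrow> \<exists>s'. s \<rightarrow>\<^sup>* s' \<and> s' \<prec> t'"
proof (induction rule: rtranclp_induct)
  case (step t' t'')
  then show ?case by (meson expands_trans left_subterm_expands1)
qed blast

text \<open>All left subterms lie on the single leftmost branch.\<close>

lemma left_subterm_linear: "s \<prec> t \<Longrightarrow> r \<prec> t \<Longrightarrow> s = r \<or> s \<prec> r \<or> r \<prec> s"
  by (induction arbitrary: r rule: left_subterm.induct) (auto elim!: left_subtermE)

text \<open>Multiplied by the same large right power, both terms become equivalent. In a common
  expansion \<open>r\<close>, expansions of \<open>s\<close> and of \<open>t\<close> both lie on the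
  leftmost branch, where any two terms are comparable.\<close>

lemma LD_comparison:
  "s \<simeq> t \<or> (\<exists>s' t'. s \<simeq> s' \<and> t \<simeq> t' \<and> (s' \<prec> t' \<or> t' \<prec> s'))"
proof -
  obtain k l where k: "\<forall>n\<ge>k. s \<cdot> right_power n \<simeq> right_power (Suc n)"
    and l: "\<forall>n\<ge>l. t \<cdot> right_power n \<simeq> right_power (Suc n)"
    using right_power_absorbs by meson
  let ?n = "max k l"
  have "s \<cdot> right_power ?n \<simeq> t \<cdot> right_power ?n"
    using k l by (meson LD_equiv_sym LD_equiv_trans max.cobounded1 max.cobounded2)
  then obtain r where "s \<cdot> right_power ?n \<rightarrow>\<^sup>* r" "t \<cdot> right_power ?n \<rightarrow>\<^sup>* r"
    unfolding LD_equiv_def by blast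
  then obtain s' t' where st: "s \<rightarrow>\<^sup>* s'" "s' \<prec> r" "t \<rightarrow>\<^sup>* t'" "t' \<prec> r"
    by (meson left_subterm.left left_subterm_expands)
  then have "s \<simeq> s'" "t \<simeq> t'" by (auto simp: LD_equiv_def)
  with left_subterm_linear[OF st(2,4)] show ?thesis
    by (meson LD_equiv_sym LD_equiv_trans)
qed

section \<open>Evaluation of terms and the criterion for freeness\<close>

primrec ldeval :: "('a \<Rightarrow> 'a \<Rightarrow> 'a) \<Rightarrow> 'a \<Rightarrow> ldterm \<Rightarrow> 'a" where
  "ldeval f x Var = x"
| "ldeval f x (s \<cdot> t) = f (ldeval f x s) (ldeval f x t)"

lemma op_closure_singleton: "op_closure f {x} = range (ldeval f x)"
proof (intro equalityI subsetI)
  fix y assume "y \<in> op_closure f {x}"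
  then have "\<exists>t. y = ldeval f x t"
  proof induction
    case (base y)
    then show ?case by (intro exI[of _ Var]) simp
  next
    case (opn u v)
    then obtain s t where "u = ldeval f x s" "v = ldeval f x t" by blast
    then show ?case by (intro exI[of _ "s \<cdot> t"]) simp
  qed
  then show "y \<in> range (ldeval f x)" by blast
next
  fix y assume "y \<in> range (ldeval f x)"
  then obtain t where "y = ldeval f x t" by blast
  moreover have "ldeval f x t \<in> op_closure f {x}"
    by (induction t) (auto intro: op_closure.intros)
  ultimately show "y \<in> op_closure f {x}" by simp
qed

context LD_system
begin

lemma ldeval_closed: "x \<in> S \<Longrightarrow> ldeval opn x t \<in> S"
  by (induction t) (auto intro: closed)

lemma ldeval_LD_equiv:
  assumes x: "x \<in> S" and "s \<simeq> t"
  shows "ldeval opn x s = ldeval opn x t"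
proof -
  have 1: "expands1 s t \<Longrightarrow> ldeval opn x s = ldeval opn x t" for s t
    by (induction rule: expands1.induct) (auto simp: left_distrib ldeval_closed x)
  have "s \<rightarrow>\<^sup>* t \<Longrightarrow> ldeval opn x s = ldeval opn x t" for s t
    by (induction rule: rtranclp_induct) (auto dest: 1)
  with assms(2) show ?thesis by (auto simp: LD_equiv_def)
qed

text \<open>Inequivalent terms are equivalent to two terms of which one is a left subterm of the
  other; equal values would then contradict acyclicity.\<close>

lemma LD_equiv_iff_ldeval_eq:
  assumes x: "x \<in> S" and acyclic: "\<And>s t. s \<prec> t \<Longrightarrow> ldeval opn x s \<noteq> ldeval opn x t"
  shows "s \<simeq> t \<longleftrightarrow> ldeval opn x s = ldeval opn x t"
proof
  assume eq: "ldeval opn x s = ldeval opn x t"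
  show "s \<simeq> t"
  proof (rule ccontr)
    assume "\<not> s \<simeq> t"
    then obtain s' t' where st: "s \<simeq> s'" "t \<simeq> t'" and "s' \<prec> t' \<or> t' \<prec> s'"
      using LD_comparison[of s t] by blast
    moreover have "ldeval opn x s' = ldeval opn x t'"
      using eq ldeval_LD_equiv[OF x st(1)] ldeval_LD_equiv[OF x st(2)] by simp
    ultimately show False using acyclic[of s' t'] acyclic[of t' s'] by auto
  qed
qed (rule ldeval_LD_equiv[OF x])

lemma LD_system_op_closure:
  assumes "X \<subseteq> S"
  shows "LD_system (op_closure opn X) opn"
proof -
  have "op_closure opn X \<subseteq> S"
  proof
    show "y \<in> S" if "y \<in> op_closure opn X" for y
      using that by induction (use assms in \<open>auto intro: closed\<close>)
  qed
  then show ?thesis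
    by unfold_locales (auto intro: op_closure.opn left_distrib)
qed

end

text \<open>Acyclicity makes the closure a copy of the terms modulo \<open>\<simeq>\<close>, and
  these map to any LD-system by evaluation at the image of the generator.\<close>

theorem free_LD_system_singletonI:
  assumes "LD_system S opS" and x: "x \<in> S"
    and acyclic: "\<And>s t. s \<prec> t \<Longrightarrow> ldeval opS x s \<noteq> ldeval opS x t"
  shows "free_LD_system TYPE('b) (op_closure opS {x}) opS {x}"
  unfolding free_LD_system_def
proof (intro conjI allI impI)
  interpret LD_system S opS by fact
  show "LD_system (op_closure opS {x}) opS" using x by (intro LD_system_op_closure) simp
  show "{x} \<subseteq> op_closure opS {x}" by (auto intro: op_closure.base)
  fix T :: "'b set" and opT and f
  assume "LD_system T opT \<and> f \<in> {x} \<rightarrow> T"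
  then interpret T: LD_system T opT by blast
  have fx: "f x \<in> T" using \<open>LD_system T opT \<and> f \<in> {x} \<rightarrow> T\<close> by blast
  let ?C = "op_closure opS {x}" and ?e = "ldeval opS x" and ?d = "ldeval opT (f x)"
  have C: "?C = range ?e" by (rule op_closure_singleton)
  have in_C: "?e t \<in> ?C" for t unfolding C by (rule rangeI)
  have CE: "\<exists>t. y = ?e t" if "y \<in> ?C" for y using that unfolding C by (rule rangeE) blast
  have ed: "?e s = ?e t \<Longrightarrow> ?d s = ?d t" for s t
    using LD_equiv_iff_ldeval_eq[OF x acyclic] T.ldeval_LD_equiv[OF fx] by metis
  \<comment> \<open>By \<open>ed\<close> the value does not depend on the chosen term. Outside
    \<open>?C\<close> the function is \<open>undefined\<close>, since \<open>LD_hom\<close> consists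
    of extensional functions.\<close>
  define h where "h = (\<lambda>y\<in>?C. ?d (SOME t. ?e t = y))"
  have h: "h (?e t) = ?d t" for t
  proof -
    have "?e (SOME s. ?e s = ?e t) = ?e t" by (rule someI) simp
    then have "?d (SOME s. ?e s = ?e t) = ?d t" by (rule ed)
    then show ?thesis using in_C by (simp add: h_def)
  qed
  have "h \<in> ?C \<rightarrow>\<^sub>E T"
  proof (rule PiE_I)
    show "h y \<in> T" if y: "y \<in> ?C" for y
    proof -
      obtain t where "y = ?e t" using CE[OF y] by blast
      then show ?thesis using h T.ldeval_closed[OF fx] by simp
    qed
    show "h y = undefined" if "y \<notin> ?C" for y using that by (simp add: h_def)
  qed
  moreover have "h (opS u v) = opT (h u) (h v)" if u: "u \<in> ?C" and v: "v \<in> ?C" for u v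
  proof -
    obtain s t where "u = ?e s" "v = ?e t" using CE[OF u] CE[OF v] by blast
    then show ?thesis using h[of "s \<cdot> t"] h[of s] h[of t] by simp
  qed
  ultimately have hom: "h \<in> LD_hom ?C opS T opT" by (simp add: LD_hom_def)
  show "\<exists>!h. h \<in> LD_hom ?C opS T opT \<and> (\<forall>y\<in>{x}. h y = f y)"
  proof (rule ex1I)
    show "h \<in> LD_hom ?C opS T opT \<and> (\<forall>y\<in>{x}. h y = f y)"
      using hom h[of Var] by simp
  next
    fix g assume g: "g \<in> LD_hom ?C opS T opT \<and> (\<forall>y\<in>{x}. g y = f y)"
    have "g (?e t) = ?d t" for t
    proof (induction t)
      case (App s t)
      then show ?case using g in_C by (simp add: LD_hom_def)
    qed (use g in simp)
    then have "g y = h y" if y: "y \<in> ?C" for y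
    proof -
      obtain t where "y = ?e t" using CE[OF y] by blast
      then show ?thesis using \<open>\<And>t. g (?e t) = ?d t\<close> h by simp
    qed
    moreover have "g \<in> ?C \<rightarrow>\<^sub>E T" "h \<in> ?C \<rightarrow>\<^sub>E T"
      using g hom by (simp_all add: LD_hom_def)
    ultimately show "g = h" by (intro PiE_ext)
  qed
qed

section \<open>Free reduction of words\<close>

definition linv :: "'x \<times> bool \<Rightarrow> 'x \<times> bool" where
  "linv l = (fst l, \<not> snd l)"

lemma linv_simps [simp]: "linv (x, b) = (x, \<not> b)" "fst (linv l) = fst l" "linv (linv l) = l"
  "linv l \<noteq> l" "l \<noteq> linv l"
  by (cases l, auto simp: linv_def)+

definition winv :: "'x word \<Rightarrow> 'x word" where
  "winv w = rev (map linv w)"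

lemma winv_simps [simp]: "winv [] = []" "winv (l # w) = winv w @ [linv l]"
  "winv (u @ v) = winv v @ winv u" "winv (winv w) = w"
  by (auto simp: winv_def rev_map o_def)

fun push :: "'x \<times> bool \<Rightarrow> 'x word \<Rightarrow> 'x word" where
  "push l [] = [l]"
| "push l (m # w) = (if m = linv l then w else l # m # w)"

text \<open>The normal form in the free group, computed from the right end. No quotient is formed:
  two words denote the same element when their values of \<open>red\<close> agree.\<close>

definition red :: "'x word \<Rightarrow> 'x word" where
  "red w = foldr push w []"

lemma red_simps [simp]: "red [] = []" "red (l # w) = push l (red w)"
  by (simp_all add: red_def)

fun reduced :: "'x word \<Rightarrow> bool" where
  "reduced (l # m # w) \<longleftrightarrow> m \<noteq> linv l \<and> reduced (m # w)"
| "reduced _ \<longleftrightarrow> True"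

lemma reduced_Cons: "reduced (l # w) \<longleftrightarrow> reduced w \<and> (w = [] \<or> hd w \<noteq> linv l)"
  by (cases w) auto

lemma reduced_push: "reduced w \<Longrightarrow> reduced (push l w)"
  by (cases w) (auto simp: reduced_Cons)

lemma reduced_red: "reduced (red w)"
  by (induction w) (auto simp: reduced_push)

lemma push_reduced: "reduced (l # w) \<Longrightarrow> push l w = l # w"
  by (cases w) auto

lemma red_reduced: "reduced w \<Longrightarrow> red w = w"
  by (induction w) (auto simp: push_reduced reduced_Cons)

lemma red_red [simp]: "red (red w) = red w"
  by (rule red_reduced[OF reduced_red])

lemma red_push_red [simp]: "red (push l (red w)) = push l (red w)"
  by (metis red_red red_simps(2))

lemma push_push_linv: "reduced w \<Longrightarrow> push l (push (linv l) w) = w"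
  by (cases w) (auto simp: reduced_Cons push_reduced)

lemma red_push_append: "red (push l u @ v) = red (l # u @ v)"
proof (cases u)
  case (Cons m u')
  then show ?thesis by (simp add: push_push_linv reduced_red)
qed simp

lemma red_append_left [simp]: "red (red u @ v) = red (u @ v)"
  by (induction u) (simp_all add: red_push_append)

lemma red_append_right [simp]: "red (u @ red v) = red (u @ v)"
  by (induction u) simp_all

lemma red_append_cong: "red u = red u' \<Longrightarrow> red v = red v' \<Longrightarrow> red (u @ v) = red (u' @ v')"
  by (metis red_append_left red_append_right)

lemma red_winv [simp]: "red (w @ winv w) = []" "red (winv w @ w) = []"
proof -
  show 1: "red (w @ winv w) = []" for w :: "'x word"
  proof (induction w)
    case (Cons l w)
    have "red ((w @ winv w) @ [linv l]) = red [linv l]"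
      using red_append_cong[of "w @ winv w" "[]" "[linv l]" "[linv l]"] Cons by simp
    then show ?case by simp
  qed simp
  show "red (winv w @ w) = []" using 1[of "winv w"] by simp
qed

lemma winv_cong: assumes "red u = red v" shows "red (winv u) = red (winv v)"
proof -
  have "red (winv u) = red (winv u @ (v @ winv v))"
    by (metis append_Nil2 red_append_right red_winv(1))
  also have "\<dots> = red ((winv u @ u) @ winv v)"
    using assms by (metis append_assoc red_append_left red_append_right)
  also have "\<dots> = red (winv v)" by (metis append_Nil red_append_left red_winv(2))
  finally show ?thesis .
qed

lemma set_push: "set (push l w) \<subseteq> insert l (set w)"
  by (cases w) auto

lemma set_red: "set (red w) \<subseteq> set w"
  by (induction w) (use set_push in fastforce)+

lemma reduced_append_left: "reduced (u @ v) \<Longrightarrow> reduced u"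
  by (induction u rule: reduced.induct) (auto simp: reduced_Cons)

lemma reduced_takeWhile: "reduced w \<Longrightarrow> reduced (takeWhile P w)"
  by (metis reduced_append_left takeWhile_dropWhile_id)

lemma reduced_append:
  "reduced u \<Longrightarrow> reduced r \<Longrightarrow> u = [] \<or> r = [] \<or> hd r \<noteq> linv (last u) \<Longrightarrow> reduced (u @ r)"
  by (induction u rule: reduced.induct) (auto simp: reduced_Cons)

text \<open>Reduction of \<open>u\<close> introduces no new letters, so its last letter stays over
  \<open>A\<close> and cannot cancel the head of \<open>r\<close>.\<close>

lemma red_append_disjoint:
  assumes "fst ` set u \<subseteq> A" and "reduced r" and "r = [] \<or> fst (hd r) \<notin> A"
  shows "red (u @ r) = red u @ r"
proof -
  have "red (u @ r) = red (red u @ r)" by simp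
  also have "reduced (red u @ r)"
  proof (rule reduced_append)
    have "fst (last (red u)) \<in> A" if "red u \<noteq> []"
      using that assms(1) set_red[of u] last_in_set[of "red u"] by blast
    then show "red u = [] \<or> r = [] \<or> hd r \<noteq> linv (last (red u))"
      using assms(3) by (metis linv_simps(2))
  qed (auto simp: reduced_red assms)
  then have "red (red u @ r) = red u @ r" by (rule red_reduced)
  finally show ?thesis .
qed

section \<open>Homomorphisms of free groups and control of cancellation\<close>

definition subst :: "('x \<Rightarrow> 'y word) \<Rightarrow> 'x word \<Rightarrow> 'y word" where
  "subst f w = concat (map (\<lambda>(x, b). if b then f x else winv (f x)) w)"

lemma subst_simps [simp]: "subst f [] = []"
  "subst f ((x, b) # w) = (if b then f x else winv (f x)) @ subst f w"
  "subst f (u @ v) = subst f u @ subst f v"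
  by (auto simp: subst_def)

lemma subst_winv: "subst f (winv w) = winv (subst f w)"
  by (induction w) auto

lemma subst_subst: "subst f (subst g w) = subst (\<lambda>x. subst f (g x)) w"
  by (induction w) (auto simp: subst_winv)

lemma subst_gen [simp]: "subst (\<lambda>x. [(x, True)]) w = w"
  by (induction w) auto

lemma red_subst_linv: "red (subst f [l] @ subst f [linv l] @ w) = red w"
proof -
  obtain x b where l: "l = (x, b)" by (cases l)
  have "red (subst f [l] @ subst f [linv l]) = red []" by (auto simp: l)
  from red_append_cong[OF this HOL.refl[of "red w"]] show ?thesis by simp
qed

lemma red_subst_push: "red (subst f (push l w)) = red (subst f (l # w))"
proof (cases w)
  case (Cons m w')
  have "red (subst f (l # linv l # w')) = red (subst f w')"
    using red_subst_linv[of f l "subst f w'"] by (metis append_Cons append_Nil subst_simps(3))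
  with Cons show ?thesis by simp
qed simp

lemma red_subst_red [simp]: "red (subst f (red w)) = red (subst f w)"
proof (induction w)
  case (Cons l w)
  then have "red (subst f [l] @ subst f (red w)) = red (subst f [l] @ subst f w)"
    by (intro red_append_cong) simp
  then show ?case by (metis append_Cons append_Nil red_simps(2) red_subst_push subst_simps(3))
qed simp

lemma subst_cong: "red u = red v \<Longrightarrow> red (subst f u) = red (subst f v)"
  by (metis red_subst_red)

lemma subst_cong_gen:
  assumes "\<And>x. red (f x) = red (g x)"
  shows "red (subst f w) = red (subst g w)"
proof (induction w)
  case (Cons l w)
  obtain x b where "l = (x, b)" by (cases l)
  then show ?case using Cons assms[of x] winv_cong by (auto intro: red_append_cong)
qed simp

text \<open>Although \<open>f\<close> does not preserve reduced words, no cancellation reaches the first letter over \<open>A\<close>.\<close>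

lemma red_subst_split:
  assumes fixed: "\<And>x. x \<in> A \<Longrightarrow> f x = [(x, True)]"
    and stable: "\<And>x. x \<notin> A \<Longrightarrow> fst ` set (f x) \<subseteq> - A"
    and left_inverse: "\<And>w. red (subst g (subst f w)) = red w"
    and "reduced w"
  shows "\<exists>r. reduced r \<and> red (subst f w) = red (subst f (takeWhile (\<lambda>l. fst l \<notin> A) w)) @ r \<and>
    (case dropWhile (\<lambda>l. fst l \<notin> A) w of [] \<Rightarrow> r = [] | m # v \<Rightarrow> r \<noteq> [] \<and> hd r = m)"
  using \<open>reduced w\<close>
proof (induction w)
  case (Cons l w)
  let ?t = "takeWhile (\<lambda>l. fst l \<notin> A)" and ?d = "dropWhile (\<lambda>l. fst l \<notin> A)"
  have "reduced w" and lw: "w = [] \<or> hd w \<noteq> linv l" using Cons.prems by (auto simp: reduced_Cons)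
  then obtain r where r: "reduced r" "red (subst f w) = red (subst f (?t w)) @ r"
    and hd_r: "case ?d w of [] \<Rightarrow> r = [] | m # v \<Rightarrow> r \<noteq> [] \<and> hd r = m" using Cons.IH by blast
  obtain x b where l: "l = (x, b)" by (cases l)
  have fA: "fst ` set (subst f u) \<subseteq> - A" if "fst ` set u \<subseteq> - A" for u
    using that
  proof (induction u)
    case (Cons m u)
    obtain y c where m: "m = (y, c)" by (cases m)
    have "fst ` set (winv (f y)) = fst ` set (f y)"
      by (auto simp: winv_def image_iff) (metis fst_conv linv_simps(2))+
    then show ?case using Cons m stable[of y] by (auto simp: image_Un simp del: image_subset_iff)
  qed simp
  have tA: "fst ` set (?t u) \<subseteq> - A" for u :: "('a \<times> bool) list"
    by (auto dest: set_takeWhileD)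
  have r_A: "r = [] \<or> fst (hd r) \<notin> - A"
    using hd_r hd_dropWhile[of "\<lambda>l. fst l \<notin> A" w] by (cases "?d w") auto
  show ?case
  proof (cases "x \<in> A")
    case True
    have sl: "red (subst f (l # w)) = push l (red (subst f (?t w)) @ r)"
      using fixed[OF True] r by (simp add: l)
    have red_l: "reduced (l # red (subst f (?t w)) @ r)"
    proof (cases "?t w = []")
      case True
      then have "?d w = w" by (metis append_Nil takeWhile_dropWhile_id)
      then have "w = [] \<longleftrightarrow> r = []" "w \<noteq> [] \<Longrightarrow> hd r = hd w"
        using hd_r by (cases w; simp)+
      then show ?thesis using lw r(1) by (cases "r = []") (auto simp: True reduced_Cons)
    next
      case False
      \<comment> \<open>By \<open>left_inverse\<close> the image of a nontrivial block is
        nontrivial. Its letters lie outside \<open>A\<close>, so they separate \<open>l\<close> from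
        \<open>r\<close> and do not cancel with \<open>l\<close>.\<close>
      have "red (?t w) \<noteq> []"
        using False red_reduced[OF reduced_takeWhile[OF \<open>reduced w\<close>]] by metis
      then have "red (subst f (?t w)) \<noteq> []"
        using left_inverse[of "?t w"] by (metis red_simps(1) red_subst_red subst_simps(1))
      moreover have "fst ` set (red (subst f (?t w))) \<subseteq> - A"
        using set_red fA[OF tA] by blast
      moreover have "reduced (red (subst f (?t w)) @ r)"
        by (metis r(2) reduced_red)
      ultimately show ?thesis using True
        by (auto simp: reduced_Cons l) (metis ComplD fst_conv hd_in_set image_subset_iff)
    qed
    then have "red (subst f (l # w)) = l # red (subst f (?t w)) @ r"
      unfolding sl by (rule push_reduced)
    then show ?thesis using True red_l l by (intro exI) auto
  next
    case False
    have "red (subst f (l # w)) = red (subst f [l] @ red (subst f (?t w)) @ r)"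
      using r(2) by (metis append_Cons append_Nil red_append_right subst_simps(3))
    also have "\<dots> = red ((subst f [l] @ subst f (?t w)) @ r)"
      by (metis append_assoc red_append_left red_append_right)
    also have "\<dots> = red (subst f (?t (l # w)) @ r)" using False by (simp add: l)
    also have "\<dots> = red (subst f (?t (l # w))) @ r"
      by (rule red_append_disjoint[OF fA[OF tA] r(1) r_A])
    finally show ?thesis using False r(1) hd_r by (auto simp: l)
  qed
qed simp

text \<open>Here \<open>f\<close> conjugates the generators in \<open>B\<close> by \<open>e\<close>.
  The first letter of \<open>w\<close> not over \<open>e\<close> survives as the head of
  \<open>r\<close>; in front of it stands the initial power of \<open>e\<close>, with one more
  factor \<open>e\<close> exactly when that letter is over \<open>B\<close>. The induction carries
  this exact prefix along.\<close>

lemma red_subst_conj_split: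
  assumes e: "e \<notin> B" and "reduced w"
  defines "f \<equiv> \<lambda>x. if x \<in> B then [(e, True), (x, True), (e, False)] else [(x, True)]"
  shows "\<exists>r. reduced r \<and>
    (case dropWhile (\<lambda>l. fst l = e) w of [] \<Rightarrow> r = [] | m # v \<Rightarrow> r \<noteq> [] \<and> hd r = m) \<and>
    red (subst f w) = red (takeWhile (\<lambda>l. fst l = e) w @
      (if r \<noteq> [] \<and> fst (hd r) \<in> B then [(e, True)] else [])) @ r"
  using \<open>reduced w\<close>
proof (induction w)
  case (Cons l w)
  let ?t = "takeWhile (\<lambda>l. fst l = e)" and ?d = "dropWhile (\<lambda>l. fst l = e)"
  let ?e = "\<lambda>r :: ('a \<times> bool) list. if r \<noteq> [] \<and> fst (hd r) \<in> B then [(e, True)] else []"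
  have "reduced w" and lw: "w = [] \<or> hd w \<noteq> linv l" using Cons.prems by (auto simp: reduced_Cons)
  then obtain r where r: "reduced r" "red (subst f w) = red (?t w @ ?e r) @ r"
    and hd_r: "case ?d w of [] \<Rightarrow> r = [] | m # v \<Rightarrow> r \<noteq> [] \<and> hd r = m" using Cons.IH by blast
  obtain x b where l: "l = (x, b)" by (cases l)
  have te: "fst ` set (?t u) \<subseteq> {e}" for u :: "('a \<times> bool) list"
    by (auto dest: set_takeWhileD)
  have r_e: "r = [] \<or> fst (hd r) \<notin> {e}"
    using hd_r hd_dropWhile[of "\<lambda>l. fst l = e" w] by (cases "?d w") auto
  have t_Nil: "w = [] \<longleftrightarrow> r = []" "w \<noteq> [] \<Longrightarrow> hd r = hd w" if "?t w = []"
  proof -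
    have "?d w = w" using that by (metis append_Nil takeWhile_dropWhile_id)
    then show "w = [] \<longleftrightarrow> r = []" "w \<noteq> [] \<Longrightarrow> hd r = hd w"
        using hd_r by (cases w; simp)+
  qed
  have red_r: "reduced (red (u @ v) @ r)" if "fst ` set u \<subseteq> {e}" "fst ` set v \<subseteq> {e}" for u v
  proof -
    have "red ((u @ v) @ r) = red (u @ v) @ r"
      by (rule red_append_disjoint[where A = "{e}"]) (use that r r_e in auto)
    then show ?thesis by (metis reduced_red)
  qed
  have reduced_Cons_red: "reduced (l # red u @ r)"
    if u: "fst ` set u \<subseteq> {e}" and "x \<noteq> e" and "red u = [] \<Longrightarrow> r = [] \<or> hd r \<noteq> linv l" for u
  proof -
    have "fst (hd (red u)) = e" if "red u \<noteq> []"
      using that u set_red[of u] hd_in_set[of "red u"] by blast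
    then have "red u \<noteq> [] \<Longrightarrow> hd (red u) \<noteq> linv l" using \<open>x \<noteq> e\<close> l by auto
    moreover have "reduced (red u @ r)" using red_r[of u "[]"] u by simp
    ultimately show ?thesis using that(3) by (cases "red u = []") (auto simp: reduced_Cons)
  qed
  have e_r: "fst ` set (?e r) \<subseteq> {e}" by auto
  have t_red: "?t w = [] \<longleftrightarrow> red (?t w) = []"
    using red_reduced[OF reduced_takeWhile[OF \<open>reduced w\<close>]] by metis
  have subst_w: "red (subst f w) = red (red (?t w @ ?e r) @ r)"
    by (metis r(2) red_red)
  show ?case
  proof (cases "x = e")
    case True
    have "red (subst f (l # w)) = red (l # red (?t w @ ?e r) @ r)"
      using True e subst_w by (auto simp: l f_def)
    also have "\<dots> = red ((?t (l # w) @ ?e r) @ r)"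
      by (simp add: l True)
    also have "\<dots> = red (?t (l # w) @ ?e r) @ r"
      by (rule red_append_disjoint[where A = "{e}"]) (use te[of "l # w"] r r_e in auto)
    finally show ?thesis using True r(1) hd_r by (auto simp: l)
  next
    case nte: False
    show ?thesis
    proof (cases "x \<in> B")
      case False
      have "red (subst f (l # w)) = push l (red (?t w @ ?e r) @ r)"
        using False r(2) by (simp add: l f_def)
      moreover have red_l: "reduced (l # red (?t w @ ?e r) @ r)"
      proof (rule reduced_Cons_red)
        show "r = [] \<or> hd r \<noteq> linv l" if "red (?t w @ ?e r) = []"
        proof (cases "r \<noteq> [] \<and> fst (hd r) \<in> B")
          case False
          then have "?t w = []" using that t_red by (auto split: if_splits)
          then show ?thesis using t_Nil lw by auto
        next
          case True
          then show ?thesis using \<open>x \<notin> B\<close> by (auto simp: l)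
        qed
      qed (use te[of w] e_r nte in auto)
      ultimately have "red (subst f (l # w)) = l # red (?t w @ ?e r) @ r"
        by (simp add: push_reduced)
      then show ?thesis using red_l nte False
        by (intro exI[of _ "l # red (?t w @ ?e r) @ r"]) (simp_all add: l)
    next
      case True
      let ?u = "[(e, False)] @ ?t w @ ?e r"
      have red_l: "reduced (l # red ?u @ r)"
      proof (rule reduced_Cons_red)
        show "r = [] \<or> hd r \<noteq> linv l" if u: "red ?u = []"
        proof (cases "r \<noteq> [] \<and> fst (hd r) \<in> B")
          case True
          \<comment> \<open>If \<open>red ?u\<close> is empty, a conjugate of \<open>?t w\<close> by
            \<open>e\<close> is trivial, hence so is \<open>?t w\<close>. Then \<open>l\<close>
            directly precedes the head of \<open>w\<close>, which is also the head of
            \<open>r\<close>, in a reduced word.\<close>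
          have "red (?t w) = red ([(e, True)] @ ?u @ [(e, False)])"
          proof -
            have "red (?t w @ [(e, True), (e, False)]) = red (?t w @ [])"
              by (rule red_append_cong) simp_all
            then show ?thesis
              using True push_push_linv[OF reduced_red, of "(e, True)" "?t w"] by simp
          qed
          also have "\<dots> = red ([(e, True)] @ [] @ [(e, False)])"
            using u by (intro red_append_cong) simp_all
          finally have "?t w = []" using t_red by simp
          then show ?thesis using t_Nil lw by auto
        next
          case False
          then show ?thesis using \<open>x \<in> B\<close> by (auto simp: l)
        qed
      qed (use te[of w] e_r nte in auto)
      have "red (subst f (l # w)) = red ([(e, True), l] @ [(e, False)] @ red (?t w @ ?e r) @ r)"
        using True subst_w by (cases b) (auto simp: l f_def)
      also have "\<dots> = red ([(e, True), l] @ red (?u @ r))"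
        by simp
      also have "red (?u @ r) = red ?u @ r"
        by (rule red_append_disjoint[where A = "{e}"]) (use te[of w] r r_e in auto)
      also have "red ([(e, True), l] @ red ?u @ r) = push (e, True) (red (l # red ?u @ r))"
        by simp
      also have "red (l # red ?u @ r) = l # red ?u @ r" by (rule red_reduced[OF red_l])
      finally show ?thesis using nte True red_l
        by (intro exI[of _ "l # red ?u @ r"]) (simp_all add: l)
    qed
  qed
qed simp


section \<open>The action of parenthesized braids on a free group\<close>

text \<open>The free group has, for each strand \<open>k\<close>, a loop \<open>(k, None)\<close> and further generators
  \<open>(k, Some s)\<close>. Splitting the strand \<open>k\<close> infinitely often gives loops indexed by binary words \<open>s\<close>
  with \<open>x s = x (s @ [False]) \<cdot> x (s @ [True])\<close>; the loop at the root together with all the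
  right-hand loops \<open>x (s @ [True])\<close> is a basis, in which \<open>Some s\<close> encodes \<open>x (s @ [True])\<close>.
  This makes the action of \<open>a\<^sub>i\<close> invertible: it maps the loop \<open>i\<close> to the product of the loops \<open>i\<close>
  and \<open>i + 1\<close>. Strands are numbered from \<open>1\<close>; the spurious strand \<open>0\<close> is never moved.\<close>

type_synonym strand = "nat \<times> bool list option"

text \<open>\<open>Sig i\<close> is Artin's automorphism on loops; the other generators of strand
  \<open>i\<close> are conjugated by the same loop. \<open>Al i\<close> turns the right half
  \<open>(i, Some [])\<close> into the loop \<open>i + 1\<close> and distributes deeper splittings
  over the two strands by their first bit. The clauses for \<open>False\<close> give the
  inverses.\<close>

fun strand_img :: "pbgen \<Rightarrow> bool \<Rightarrow> strand \<Rightarrow> strand word" where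
  "strand_img (Sig i) True (k, y) =
    (if k = i then [((i, None), True), ((i + 1, y), True), ((i, None), False)]
     else if k = i + 1 then [((i, y), True)] else [((k, y), True)])"
| "strand_img (Sig i) False (k, y) =
    (if k = i then [((i + 1, y), True)]
     else if k = i + 1 then [((i + 1, None), False), ((i, y), True), ((i + 1, None), True)]
     else [((k, y), True)])"
| "strand_img (Al i) True (k, y) =
    (if k < i then [((k, y), True)] else if i < k then [((k + 1, y), True)] else
     (case y of None \<Rightarrow> [((i, None), True), ((i + 1, None), True)]
      | Some [] \<Rightarrow> [((i + 1, None), True)]
      | Some (b # s) \<Rightarrow> [((if b then i + 1 else i, Some s), True)]))"
| "strand_img (Al i) False (k, y) =
    (if k < i then [((k, y), True)] else if i + 1 < k then [((k - 1, y), True)]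
     else if k = i then (case y of None \<Rightarrow> [((i, None), True), ((i, Some []), False)]
       | Some s \<Rightarrow> [((i, Some (False # s)), True)])
     else (case y of None \<Rightarrow> [((i, Some []), True)] | Some s \<Rightarrow> [((i, Some (True # s)), True)]))"

text \<open>A left action: the last letter of the braid word acts first. The resulting words are
  left unreduced.\<close>

fun act :: "pbgen word \<Rightarrow> strand word \<Rightarrow> strand word" where
  "act [] f = f"
| "act ((g, b) # w) f = subst (strand_img g b) (act w f)"

lemma act_append: "act (u @ v) f = act u (act v f)"
  by (induction u) auto

lemma act_eq_subst: "act w f = subst (\<lambda>x. act w [(x, True)]) f"
  by (induction w) (auto simp: subst_subst)

lemma act_red_cong: "red f = red f' \<Longrightarrow> red (act w f) = red (act w f')"
  by (subst (1 2) act_eq_subst) (rule subst_cong)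

lemma act_cong_gen:
  "(\<And>x. red (act u [(x, True)]) = red (act v [(x, True)])) \<Longrightarrow> red (act u f) = red (act v f)"
  by (subst (1 2) act_eq_subst) (rule subst_cong_gen)

lemma strand_cases:
  fixes x :: strand
  obtains k where "x = (k, None)" | k where "x = (k, Some [])"
    | k b s where "x = (k, Some (b # s))"
proof (cases x)
  case (Pair k y)
  then show ?thesis
  proof (cases y)
    case None
    then show ?thesis using Pair that(1) by simp
  next
    case (Some s)
    then show ?thesis using Pair that(2,3) by (cases s) auto
  qed
qed

text \<open>In this \<open>Suc\<close> form the simplifier decides all comparisons of
  \<open>k\<close> with \<open>i\<close> and \<open>i + 1\<close>.\<close>

lemma nat_offset_cases:
  fixes k i :: nat
  obtains "k < i" | "k = i" | "k = Suc i" | d where "k = Suc (Suc (i + d))"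
proof -
  have "k < i \<or> k = i \<or> k = Suc i \<or> (\<exists>d. k = Suc (Suc (i + d)))" by presburger
  then show thesis using that by blast
qed

lemma act_cancel: "red (act [(g, b), (g, \<not> b)] f) = red f"
proof -
  have "red (act [(g, b), (g, \<not> b)] [(x, True)]) = red (act [] [(x, True)])" for x
  proof (cases g)
    case (Sig i)
    show ?thesis unfolding Sig
      by (cases "fst x" i rule: nat_offset_cases; cases x rule: strand_cases; cases b; simp)
  next
    case (Al i)
    show ?thesis unfolding Al
      by (cases "fst x" i rule: nat_offset_cases; cases x rule: strand_cases; cases b; simp)
  qed
  then have "red (act [(g, b), (g, \<not> b)] f) = red (act [] f)"
    by (rule act_cong_gen)
  then show ?thesis by simp
qed

lemma act_rel_far:
  assumes "i + 2 \<le> j"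
  shows "red (act [\<sigma> i, \<sigma> j] [(x, True)]) = red (act [\<sigma> j, \<sigma> i] [(x, True)])"
    and "red (act [\<sigma> i, \<a> j] [(x, True)]) = red (act [\<a> j, \<sigma> i] [(x, True)])"
    and "red (act [\<a> i, \<a> (j - 1)] [(x, True)]) = red (act [\<a> j, \<a> i] [(x, True)])"
    and "red (act [\<a> i, \<sigma> (j - 1)] [(x, True)]) = red (act [\<sigma> j, \<a> i] [(x, True)])"
proof -
  obtain c where j: "j = Suc (Suc (i + c))" using assms by (metis add_2_eq_Suc' add_Suc le_Suc_ex)
  \<comment> \<open>With \<open>j = i + c + 2\<close>, the fourth case lies strictly between
    \<open>i + 1\<close> and \<open>j\<close>; the last three are \<open>j\<close>,
    \<open>j + 1\<close> and everything above.\<close>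
  consider "fst x < i" | "fst x = i" | "fst x = Suc i"
    | d where "fst x = Suc (Suc (i + d))" "d < c" | "fst x = Suc (Suc (i + c))"
    | "fst x = Suc (Suc (Suc (i + c)))" | d where "fst x = Suc (Suc (Suc (Suc (i + c + d))))"
  proof (cases "fst x" i rule: nat_offset_cases)
    case (4 d)
    then show thesis using that(4-7) by (cases d c rule: nat_offset_cases) auto
  qed (use that in simp_all)
  note cases = this
  show "red (act [\<sigma> i, \<sigma> j] [(x, True)]) = red (act [\<sigma> j, \<sigma> i] [(x, True)])"
    and "red (act [\<sigma> i, \<a> j] [(x, True)]) = red (act [\<a> j, \<sigma> i] [(x, True)])"
    and "red (act [\<a> i, \<a> (j - 1)] [(x, True)]) = red (act [\<a> j, \<a> i] [(x, True)])"
    and "red (act [\<a> i, \<sigma> (j - 1)] [(x, True)]) = red (act [\<sigma> j, \<a> i] [(x, True)])"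
    by (cases rule: cases; cases x rule: strand_cases; simp add: j)+
qed

lemma act_rel_near:
  "red (act [\<sigma> i, \<sigma> (i + 1), \<sigma> i] [(x, True)]) =
    red (act [\<sigma> (i + 1), \<sigma> i, \<sigma> (i + 1)] [(x, True)])"
  "red (act [\<sigma> (i + 1), \<sigma> i, \<a> (i + 1)] [(x, True)]) = red (act [\<a> i, \<sigma> i] [(x, True)])"
  "red (act [\<sigma> i, \<sigma> (i + 1), \<a> i] [(x, True)]) = red (act [\<a> (i + 1), \<sigma> i] [(x, True)])"
proof -
  consider "fst x < i" | "fst x = i" | "fst x = Suc i" | "fst x = Suc (Suc i)"
    | d where "fst x = Suc (Suc (Suc (i + d)))"
  proof (cases "fst x" i rule: nat_offset_cases)
    case (4 d)
    then show thesis using that(4,5) by (cases d) auto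
  qed (use that in simp_all)
  note cases = this
  show "red (act [\<sigma> i, \<sigma> (i + 1), \<sigma> i] [(x, True)]) =
      red (act [\<sigma> (i + 1), \<sigma> i, \<sigma> (i + 1)] [(x, True)])"
    and "red (act [\<sigma> (i + 1), \<sigma> i, \<a> (i + 1)] [(x, True)]) = red (act [\<a> i, \<sigma> i] [(x, True)])"
    and "red (act [\<sigma> i, \<sigma> (i + 1), \<a> i] [(x, True)]) = red (act [\<a> (i + 1), \<sigma> i] [(x, True)])"
    by (cases rule: cases; cases x rule: strand_cases; simp)+
qed

lemma act_pbrels:
  assumes "(u, v) \<in> pbrels"
  shows "red (act u f) = red (act v f)"
proof (rule act_cong_gen)
  fix x :: strand
  note rels = act_rel_far act_rel_near
  show "red (act u [(x, True)]) = red (act v [(x, True)])"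
    by (insert assms[unfolded pbrels_def Un_iff mem_Collect_eq prod.inject],
        elim disjE exE conjE; simp only:; rule rels; simp)
qed

text \<open>Hence the action on elements of the free group depends only on the parenthesized braid,
  not on the word for it.\<close>

lemma act_presented_cong:
  assumes "(u, v) \<in> presented_cong pbgens pbrels"
  shows "red (act u f) = red (act v f)"
  using assms
proof (induction arbitrary: f)
  case (append u u' v v')
  then show ?case by (metis act_append act_red_cong)
qed (simp_all add: act_pbrels act_cancel del: act.simps(2))

section \<open>Words starting with the first loop under shifted elements and
  \<open>\<sigma> 1\<close>\<close>

abbreviation base_loop :: "strand" where "base_loop \<equiv> (1, None)"

definition pos_start :: "strand word \<Rightarrow> bool" where
  "pos_start f \<longleftrightarrow> (\<exists>w. red f = (base_loop, True) # w)"

text \<open>A shifted generator fixes everything on strands up to \<open>1\<close> and keeps the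
  other strands among themselves. The leading \<open>base_loop\<close> is thus a first letter over
  \<open>?A\<close> with nothing before it, and \<open>red_subst_split\<close> keeps it in
  front.\<close>

lemma act_shift_word:
  assumes "w \<in> words pbgens"
  shows "act (shift_word w) [(base_loop, b)] = [(base_loop, b)]"
    and "pos_start f \<Longrightarrow> pos_start (act (shift_word w) f)"
proof -
  let ?A = "{x :: strand. fst x \<le> 1}"
  have fixed: "strand_img (shift_gen g) b x = [(x, True)]" if "g \<in> pbgens" "x \<in> ?A" for g b x
    using that by (cases g; cases b; cases x) (auto simp: pbgens_def)
  have "act (shift_word w) [(base_loop, b)] = [(base_loop, b)] \<and>
    (pos_start f \<longrightarrow> pos_start (act (shift_word w) f))"
    using assms
  proof (induction w)
    case Nil
    then show ?case by (simp add: shift_word_def)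
  next
    case (Cons l w)
    obtain g c where l: "l = (g, c)" by (cases l)
    let ?f = "strand_img (shift_gen g)"
    have g: "g \<in> pbgens" and w: "w \<in> words pbgens" using Cons.prems by (auto simp: words_def l)
    have sw: "act (shift_word (l # w)) h = subst (?f c) (act (shift_word w) h)" for h
      by (simp add: shift_word_def l)
    have base: "act (shift_word (l # w)) [(base_loop, b)] = [(base_loop, b)]"
      unfolding sw using Cons.IH[OF w] fixed[OF g, of base_loop c] by simp
    have "pos_start (subst (?f c) h)" if "pos_start h" for h
    proof -
      obtain v where v: "red h = (base_loop, True) # v" using \<open>pos_start h\<close> pos_start_def by blast
      have "\<exists>r. reduced r \<and>
          red (subst (?f c) (red h)) = red (subst (?f c) (takeWhile (\<lambda>l. fst l \<notin> ?A) (red h))) @ r \<and>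
          (case dropWhile (\<lambda>l. fst l \<notin> ?A) (red h) of [] \<Rightarrow> r = [] | m # v \<Rightarrow> r \<noteq> [] \<and> hd r = m)"
      proof (rule red_subst_split[where g = "?f (\<not> c)"])
        show "?f c x = [(x, True)]" if "x \<in> ?A" for x by (rule fixed[OF g that])
        show "fst ` set (?f c x) \<subseteq> - ?A" if "x \<notin> ?A" for x
          using that g by (cases g; cases c; cases x)
            (auto simp: pbgens_def split: option.splits list.splits)
        show "red (subst (?f (\<not> c)) (subst (?f c) u)) = red u" for u
          using act_cancel[of "shift_gen g" "\<not> c" u] by simp
      qed (rule reduced_red)
      moreover have "takeWhile (\<lambda>l. fst l \<notin> ?A) (red h) = []"
        "dropWhile (\<lambda>l. fst l \<notin> ?A) (red h) = (base_loop, True) # v"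
        by (simp_all add: v)
      ultimately obtain r where "red (subst (?f c) h) = r" "r \<noteq> [] \<and> hd r = (base_loop, True)"
        unfolding red_subst_red by auto
      then show ?thesis by (cases r) (auto simp: pos_start_def)
    qed
    then show ?case using base Cons.IH[OF w] unfolding sw by blast
  qed
  then show "act (shift_word w) [(base_loop, b)] = [(base_loop, b)]"
    and "pos_start f \<Longrightarrow> pos_start (act (shift_word w) f)" by blast+
qed

lemma red_map_inj:
  assumes "inj \<pi>" shows "red (map (map_prod \<pi> id) w) = map (map_prod \<pi> id) (red w)"
proof -
  have "push (map_prod \<pi> id l) (map (map_prod \<pi> id) w) = map (map_prod \<pi> id) (push l w)" for l w
    using injD[OF assms] by (cases l; cases w) (auto simp: linv_def prod_eq_iff)
  then show ?thesis by (induction w) simp_all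
qed

lemma act_sigma1:
  assumes "f = [(base_loop, False)] \<or> pos_start f"
  shows "pos_start (act [\<sigma> 1] f)"
  using assms
proof
  assume "f = [(base_loop, False)]"
  \<comment> \<open>With \<open>x\<close> and \<open>y\<close> the loops \<open>1\<close> and
    \<open>2\<close>, the inverse of \<open>x\<close> goes to \<open>x\<close>, inverse of
    \<open>y\<close>, inverse of \<open>x\<close>, which is already reduced.\<close>
  then show ?thesis by (simp add: pos_start_def)
next
  assume "pos_start f"
  then obtain v where v: "red f = (base_loop, True) # v" by (auto simp: pos_start_def)
  txt \<open>\<open>\<sigma>\<^sub>1\<close> first exchanges strands \<open>1\<close> and \<open>2\<close>, then conjugates the new strand \<open>2\<close> by the loop \<open>1\<close>.\<close>
  define \<pi> :: "strand \<Rightarrow> strand" where "\<pi> = apfst (id (1 := 2, 2 := 1))"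
  have "inj \<pi>" by (auto simp: \<pi>_def inj_def split: if_splits)
  let ?B = "{x :: strand. fst x = 2}"
  define \<kappa> where
    "\<kappa> = (\<lambda>x. if x \<in> ?B then [(base_loop, True), (x, True), (base_loop, False)] else [(x, True)])"
  have \<pi>: "subst (\<lambda>x. [(\<pi> x, True)]) w = map (map_prod \<pi> id) w" for w
    by (induction w) auto
  have "strand_img (Sig 1) True = (\<lambda>x. subst \<kappa> [(\<pi> x, True)])"
    by (rule ext) (auto simp: \<kappa>_def \<pi>_def)
  then have "subst (strand_img (Sig 1) True) f = subst \<kappa> (subst (\<lambda>x. [(\<pi> x, True)]) f)"
    by (simp add: subst_subst)
  then have "red (act [\<sigma> 1] f) = red (subst \<kappa> (red (map (map_prod \<pi> id) f)))"
    by (simp add: \<pi>)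
  also have red_map: "red (map (map_prod \<pi> id) f) = ((2, None), True) # map (map_prod \<pi> id) v"
    unfolding red_map_inj[OF \<open>inj \<pi>\<close>] v by (simp add: \<pi>_def)
  finally have *: "red (act [\<sigma> 1] f) = red (subst \<kappa> (((2, None), True) # map (map_prod \<pi> id) v))" .
  have "reduced (((2, None), True) # map (map_prod \<pi> id) v)"
    by (metis red_map reduced_red)
  \<comment> \<open>The word starts over \<open>?B\<close>, so no power of \<open>base_loop\<close>
    precedes its head, and the prefix in the split is a single positive
    \<open>base_loop\<close>.\<close>
  from red_subst_conj_split[OF _ this, of base_loop ?B] show ?thesis
    unfolding pos_start_def * by (auto simp: \<kappa>_def)
qed

section \<open>Acyclicity of left division\<close>

lemma (in group) commute_inv:
  assumes "x \<in> carrier G" "y \<in> carrier G" and "x \<otimes> y = y \<otimes> x"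
  shows "x \<otimes> inv y = inv y \<otimes> x"
proof -
  have "x \<otimes> inv y = inv y \<otimes> (y \<otimes> x) \<otimes> inv y"
    using assms(1,2) by (simp add: m_assoc[symmetric])
  also have "\<dots> = inv y \<otimes> x"
    unfolding assms(3)[symmetric] using assms(1,2) by (simp add: m_assoc)
  finally show ?thesis .
qed

text \<open>In the application the elements are \<open>a = \<partial> u\<close>, \<open>b = \<partial> v\<close>, \<open>A = \<partial> (\<partial> u)\<close>, \<open>B = \<partial> (\<partial> v)\<close>,
  \<open>D = \<partial> (\<partial> w)\<close>, \<open>c = \<sigma>\<^sub>1\<close> and \<open>d = \<sigma>\<^sub>2\<close>.\<close>

lemma (in group) bracket_self_distributive:
  assumes [simp]: "u \<in> carrier G" "a \<in> carrier G" "A \<in> carrier G" "b \<in> carrier G"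
    "B \<in> carrier G" "D \<in> carrier G" "c \<in> carrier G" "d \<in> carrier G"
    and comm: "c \<otimes> A = A \<otimes> c" "c \<otimes> B = B \<otimes> c" "c \<otimes> D = D \<otimes> c"
    and braid: "c \<otimes> d \<otimes> c = d \<otimes> c \<otimes> d"
  shows "u \<otimes> (b \<otimes> D \<otimes> d \<otimes> inv B) \<otimes> c \<otimes> inv a =
    (u \<otimes> b \<otimes> c \<otimes> inv a) \<otimes> (a \<otimes> D \<otimes> d \<otimes> inv A) \<otimes> c \<otimes> inv (a \<otimes> B \<otimes> d \<otimes> inv A)"
proof -
  have cancel: "inv x \<otimes> (x \<otimes> y) = y" "x \<otimes> (inv x \<otimes> y) = y"
    if "x \<in> carrier G" "y \<in> carrier G" for x y
    using that by (simp_all add: m_assoc[symmetric])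
  have move: "c \<otimes> (x \<otimes> y) = x \<otimes> (c \<otimes> y)"
    if "c \<otimes> x = x \<otimes> c" "x \<in> carrier G" "y \<in> carrier G" for x y
    using that by (simp add: m_assoc[symmetric])
  have braid': "c \<otimes> (d \<otimes> (c \<otimes> y)) = d \<otimes> (c \<otimes> (d \<otimes> y))" if "y \<in> carrier G" for y
    using braid that by (simp add: m_assoc[symmetric])
  show ?thesis
    by (simp add: m_assoc inv_mult_group cancel braid' comm move[OF comm(1)] move[OF comm(2)]
      move[OF comm(3)] move[OF commute_inv[OF _ _ comm(2)]])
qed

section \<open>Left self-distributivity of the bracket on parenthesized braids\<close>

interpretation PB: group "B\<^sub>\<bullet>"
  by (rule group_PB)

lemma pbclass_eqI: "(u, v) \<in> presented_cong pbgens pbrels \<Longrightarrow> pbclass u = pbclass v"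
  unfolding pbclass_def by (rule equiv_class_eq[OF equiv_presented_cong[OF pbrels_words]])

lemma pbclass_eqD:
  "pbclass u = pbclass v \<Longrightarrow> v \<in> words pbgens \<Longrightarrow> (u, v) \<in> presented_cong pbgens pbrels"
  unfolding pbclass_def by (rule eq_equiv_class[OF _ equiv_presented_cong[OF pbrels_words]])

lemma pbclass_carrier [simp]: "w \<in> words pbgens \<Longrightarrow> pbclass w \<in> carrier B\<^sub>\<bullet>"
  by (simp add: carrier_PB)

lemma words_pbgens_append [simp]:
  "u @ v \<in> words pbgens \<longleftrightarrow> u \<in> words pbgens \<and> v \<in> words pbgens"
  by (simp add: words_def)

lemma words_pbgens_Cons [simp]:
  "l # w \<in> words pbgens \<longleftrightarrow> fst l \<in> pbgens \<and> w \<in> words pbgens"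
  by (cases l) (simp add: words_def)

lemma words_pbgens_Nil [simp]: "[] \<in> words pbgens"
  by (simp add: words_def)

lemma pbgens_iff [simp]: "Sig i \<in> pbgens \<longleftrightarrow> 1 \<le> i" "Al i \<in> pbgens \<longleftrightarrow> 1 \<le> i"
  by (auto simp: pbgens_def)

lemma one_PB: "\<one>\<^bsub>B\<^sub>\<bullet>\<^esub> = pbclass []"
  by (simp add: PB_def presented_group_def pbclass_def)

lemma pbclass_inv:
  assumes "g \<in> pbgens"
  shows "pbclass [(g, False)] = inv\<^bsub>B\<^sub>\<bullet>\<^esub> (pbclass [(g, True)])"
proof (rule PB.inv_equality[symmetric])
  have "pbclass [(g, False), (g, True)] = pbclass []"
    using presented_cong.cancel[OF assms, of False] by (intro pbclass_eqI) simp
  then show "pbclass [(g, False)] \<otimes>\<^bsub>B\<^sub>\<bullet>\<^esub> pbclass [(g, True)] = \<one>\<^bsub>B\<^sub>\<bullet>\<^esub>"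
    using assms by (simp add: mult_pbclass one_PB)
qed (use assms in simp_all)

lemma shift_carrier [simp]: "x \<in> carrier B\<^sub>\<bullet> \<Longrightarrow> \<partial> x \<in> carrier B\<^sub>\<bullet>"
  using pbshift_hom by (auto simp: hom_def)

lemma shift_mult:
  "x \<in> carrier B\<^sub>\<bullet> \<Longrightarrow> y \<in> carrier B\<^sub>\<bullet> \<Longrightarrow> \<partial> (x \<otimes>\<^bsub>B\<^sub>\<bullet>\<^esub> y) = \<partial> x \<otimes>\<^bsub>B\<^sub>\<bullet>\<^esub> \<partial> y"
  using pbshift_hom by (auto simp: hom_def)

lemma shift_inv: "x \<in> carrier B\<^sub>\<bullet> \<Longrightarrow> \<partial> (inv\<^bsub>B\<^sub>\<bullet>\<^esub> x) = inv\<^bsub>B\<^sub>\<bullet>\<^esub> (\<partial> x)"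
  using group_hom.hom_inv[of "B\<^sub>\<bullet>" "B\<^sub>\<bullet>" \<partial> x]
  by (simp add: group_hom_def group_hom_axioms_def pbshift_hom group_PB)

text \<open>Two shifts raise every index to at least \<open>3\<close>, where the generators commute
  with \<open>\<sigma> 1\<close> by the far relations. Inverse letters follow by
  \<open>commute_inv\<close>, words by induction.\<close>

lemma sigma1_commute:
  assumes "x \<in> carrier B\<^sub>\<bullet>"
  shows "pbclass [\<sigma> 1] \<otimes>\<^bsub>B\<^sub>\<bullet>\<^esub> \<partial> (\<partial> x) = \<partial> (\<partial> x) \<otimes>\<^bsub>B\<^sub>\<bullet>\<^esub> pbclass [\<sigma> 1]"
proof -
  let ?s = "\<lambda>w. shift_word (shift_word w)" and ?c = "pbclass [\<sigma> 1]"
  have shift_w: "?s w \<in> words pbgens" if "w \<in> words pbgens" for w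
    using that by (intro shift_word_words)
  have pos: "?c \<otimes>\<^bsub>B\<^sub>\<bullet>\<^esub> pbclass (?s [(g, True)]) = pbclass (?s [(g, True)]) \<otimes>\<^bsub>B\<^sub>\<bullet>\<^esub> ?c"
    if "g \<in> pbgens" for g
  proof -
    have "([\<sigma> 1] @ ?s [(g, True)], ?s [(g, True)] @ [\<sigma> 1]) \<in> pbrels"
      using that by (cases g) (auto simp: pbrels_def shift_word_def)
    then have "pbclass ([\<sigma> 1] @ ?s [(g, True)]) = pbclass (?s [(g, True)] @ [\<sigma> 1])"
      by (intro pbclass_eqI presented_cong.rel)
    then show ?thesis using that by (simp add: mult_pbclass shift_w)
  qed
  have letter: "?c \<otimes>\<^bsub>B\<^sub>\<bullet>\<^esub> pbclass (?s [l]) = pbclass (?s [l]) \<otimes>\<^bsub>B\<^sub>\<bullet>\<^esub> ?c" if "fst l \<in> pbgens" for l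
  proof (cases "snd l")
    case True
    then show ?thesis using pos[OF that] by (metis prod.collapse)
  next
    case False
    define g where "g = shift_gen (shift_gen (fst l))"
    have g: "?s [(fst l, True)] = [(g, True)]" "?s [l] = [(g, False)]"
      using False by (cases l; simp add: shift_word_def g_def)+
    have "g \<in> pbgens" using that by (cases "fst l") (auto simp: g_def)
    then show ?thesis
      using PB.commute_inv[of ?c "pbclass [(g, True)]"] pos[OF that]
      by (simp add: g pbclass_inv)
  qed
  have "?c \<otimes>\<^bsub>B\<^sub>\<bullet>\<^esub> pbclass (?s w) = pbclass (?s w) \<otimes>\<^bsub>B\<^sub>\<bullet>\<^esub> ?c" if "w \<in> words pbgens" for w
    using that
  proof (induction w)
    case Nil
    then show ?case by (simp add: shift_word_def mult_pbclass)
  next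
    case (Cons l w)
    have l: "fst l \<in> pbgens" and w: "w \<in> words pbgens" using Cons.prems by auto
    have [simp]: "pbclass (?s [l]) \<in> carrier B\<^sub>\<bullet>" "pbclass (?s w) \<in> carrier B\<^sub>\<bullet>" "?c \<in> carrier B\<^sub>\<bullet>"
      using l w by (auto intro!: pbclass_carrier shift_w)
    have *: "pbclass (?s (l # w)) = pbclass (?s [l]) \<otimes>\<^bsub>B\<^sub>\<bullet>\<^esub> pbclass (?s w)"
    proof -
      have "?s (l # w) = ?s [l] @ ?s w" by (simp add: shift_word_def)
      then show ?thesis using l w by (simp add: mult_pbclass shift_w)
    qed
    have "?c \<otimes>\<^bsub>B\<^sub>\<bullet>\<^esub> pbclass (?s (l # w)) = pbclass (?s [l]) \<otimes>\<^bsub>B\<^sub>\<bullet>\<^esub> (?c \<otimes>\<^bsub>B\<^sub>\<bullet>\<^esub> pbclass (?s w))"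
      unfolding * using letter[OF l] by (simp add: PB.m_assoc[symmetric])
    then show ?case unfolding * Cons.IH[OF w] by (simp add: PB.m_assoc)
  qed
  then show ?thesis
    using assms by (auto simp: carrier_PB pbshift_pbclass shift_word_words)
qed

lemma bracket_carrier [simp]:
  "u \<in> carrier B\<^sub>\<bullet> \<Longrightarrow> v \<in> carrier B\<^sub>\<bullet> \<Longrightarrow> u\<lceil>v\<rceil> \<in> carrier B\<^sub>\<bullet>"
  by (simp add: pb_bracket_def)

lemma LD_system_PB: "LD_system (carrier B\<^sub>\<bullet>) pb_bracket"
proof
  fix u v w assume [simp]: "u \<in> carrier B\<^sub>\<bullet>" "v \<in> carrier B\<^sub>\<bullet>" "w \<in> carrier B\<^sub>\<bullet>"
  let ?c = "pbclass [\<sigma> 1]" and ?d = "pbclass [\<sigma> 2]"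
  have d: "\<partial> (pbclass [\<sigma> (Suc 0)]) = ?d" using pbshift_generators(1)[of 1] by (simp add: numeral_2_eq_2)
  have "([\<sigma> 1, \<sigma> 2, \<sigma> 1], [\<sigma> 2, \<sigma> 1, \<sigma> 2]) \<in> pbrels"
    unfolding pbrels_def by (auto simp: numeral_2_eq_2)
  then have "pbclass [\<sigma> 1, \<sigma> 2, \<sigma> 1] = pbclass [\<sigma> 2, \<sigma> 1, \<sigma> 2]"
    by (intro pbclass_eqI presented_cong.rel)
  then have braid: "?c \<otimes>\<^bsub>B\<^sub>\<bullet>\<^esub> ?d \<otimes>\<^bsub>B\<^sub>\<bullet>\<^esub> ?c = ?d \<otimes>\<^bsub>B\<^sub>\<bullet>\<^esub> ?c \<otimes>\<^bsub>B\<^sub>\<bullet>\<^esub> ?d"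
    by (simp add: mult_pbclass)
  have shift_bracket: "\<partial> (x\<lceil>y\<rceil>) = \<partial> x \<otimes>\<^bsub>B\<^sub>\<bullet>\<^esub> \<partial> (\<partial> y) \<otimes>\<^bsub>B\<^sub>\<bullet>\<^esub> ?d \<otimes>\<^bsub>B\<^sub>\<bullet>\<^esub> inv\<^bsub>B\<^sub>\<bullet>\<^esub> (\<partial> (\<partial> x))"
    if "x \<in> carrier B\<^sub>\<bullet>" "y \<in> carrier B\<^sub>\<bullet>" for x y
    using that by (simp add: pb_bracket_def shift_mult shift_inv d)
  \<comment> \<open>Only the outer brackets are unfolded first, so that \<open>shift_bracket\<close>
    can rewrite the shifted inner ones; this yields exactly the identity of
    \<open>bracket_self_distributive\<close>.\<close>
  show "u\<lceil>v\<lceil>w\<rceil>\<rceil> = (u\<lceil>v\<rceil>)\<lceil>u\<lceil>w\<rceil>\<rceil>"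
    unfolding pb_bracket_def[of u "v\<lceil>w\<rceil>"] pb_bracket_def[of "u\<lceil>v\<rceil>"]
    by (simp add: shift_bracket)
      (simp add: pb_bracket_def, rule PB.bracket_self_distributive;
        simp add: sigma1_commute[simplified] braid[simplified])
qed simp

section \<open>Elements acting positively, and the absence of cycles\<close>

definition sigma_pos :: "pbgen word set set" where
  "sigma_pos = {pbclass w | w. w \<in> words pbgens \<and>
    (\<forall>f. f = [(base_loop, False)] \<or> pos_start f \<longrightarrow> pos_start (act w f))}"

lemma sigma_posI:
  assumes "w \<in> words pbgens"
    and "\<And>f. f = [(base_loop, False)] \<or> pos_start f \<Longrightarrow> pos_start (act w f)"
  shows "pbclass w \<in> sigma_pos"
  unfolding sigma_pos_def using assms by blast

lemma sigma_posE:
  assumes "p \<in> sigma_pos"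
  obtains w where "p = pbclass w" "w \<in> words pbgens"
    "\<forall>f. f = [(base_loop, False)] \<or> pos_start f \<longrightarrow> pos_start (act w f)"
  using assms unfolding sigma_pos_def by blast

lemma sigma_pos_carrier: "p \<in> sigma_pos \<Longrightarrow> p \<in> carrier B\<^sub>\<bullet>"
  by (elim sigma_posE) (simp only: pbclass_carrier)

text \<open>Read from the right: \<open>\<partial> y\<close> fixes the inverse loop and preserves a
  positive start, \<open>\<sigma> 1\<close> makes the start positive in both cases, and
  \<open>\<partial> x\<close> keeps it so.\<close>

lemma sigma_pos_shift:
  assumes "x \<in> carrier B\<^sub>\<bullet>" "y \<in> carrier B\<^sub>\<bullet>"
  shows "\<partial> x \<otimes>\<^bsub>B\<^sub>\<bullet>\<^esub> pbclass [\<sigma> 1] \<otimes>\<^bsub>B\<^sub>\<bullet>\<^esub> \<partial> y \<in> sigma_pos"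
proof -
  obtain u v where uv: "u \<in> words pbgens" "v \<in> words pbgens" "x = pbclass u" "y = pbclass v"
    using assms by (auto simp: carrier_PB)
  have "pbclass (shift_word u @ [\<sigma> 1] @ shift_word v) \<in> sigma_pos"
  proof (rule sigma_posI)
    fix f
    assume f: "f = [(base_loop, False)] \<or> pos_start f"
    have "act (shift_word v) f = [(base_loop, False)] \<or> pos_start (act (shift_word v) f)"
      using f act_shift_word[OF uv(2)] by metis
    then show "pos_start (act (shift_word u @ [\<sigma> 1] @ shift_word v) f)"
      unfolding act_append by (intro act_shift_word(2)[OF uv(1)] act_sigma1)
  qed (use uv in \<open>simp add: shift_word_words\<close>)
  moreover have "\<partial> x \<otimes>\<^bsub>B\<^sub>\<bullet>\<^esub> pbclass [\<sigma> 1] \<otimes>\<^bsub>B\<^sub>\<bullet>\<^esub> \<partial> y = pbclass (shift_word u @ [\<sigma> 1] @ shift_word v)"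
    using uv by (simp add: pbshift_pbclass mult_pbclass shift_word_words)
  ultimately show ?thesis by simp
qed

lemma sigma_pos_mult:
  assumes "p \<in> sigma_pos" "q \<in> sigma_pos"
  shows "p \<otimes>\<^bsub>B\<^sub>\<bullet>\<^esub> q \<in> sigma_pos"
proof -
  obtain u where u: "p = pbclass u" "u \<in> words pbgens"
      "\<forall>f. f = [(base_loop, False)] \<or> pos_start f \<longrightarrow> pos_start (act u f)"
    using assms(1) by (rule sigma_posE)
  obtain v where v: "q = pbclass v" "v \<in> words pbgens"
      "\<forall>f. f = [(base_loop, False)] \<or> pos_start f \<longrightarrow> pos_start (act v f)"
    using assms(2) by (rule sigma_posE)
  have "pbclass (u @ v) \<in> sigma_pos"
  proof (rule sigma_posI)
    fix f
    assume "f = [(base_loop, False)] \<or> pos_start f"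
    then have "pos_start (act v f)" using v(3) by blast
    then show "pos_start (act (u @ v) f)" unfolding act_append using u(3) by blast
  qed (use u v in simp)
  then show ?thesis using u(1,2) v(1,2) by (simp add: mult_pbclass)
qed

text \<open>The inverse of \<open>base_loop\<close> is the test word: a word for the identity fixes
  it up to reduction, yet it does not start positively.\<close>

lemma one_notin_sigma_pos: "\<one>\<^bsub>B\<^sub>\<bullet>\<^esub> \<notin> sigma_pos"
proof
  assume "\<one>\<^bsub>B\<^sub>\<bullet>\<^esub> \<in> sigma_pos"
  then obtain w where w: "pbclass w = pbclass []" and pos: "pos_start (act w [(base_loop, False)])"
    unfolding sigma_pos_def one_PB by force
  have "red (act w [(base_loop, False)]) = red (act [] [(base_loop, False)])"
    using w by (intro act_presented_cong pbclass_eqD) simp_all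
  with pos show False by (simp add: pos_start_def)
qed

text \<open>As \<open>\<partial>\<close> commutes with inverses, cancelling \<open>u\<close> on the
  left leaves a product of the shape treated in \<open>sigma_pos_shift\<close>.\<close>

lemma bracket_sigma_pos:
  assumes [simp]: "u \<in> carrier B\<^sub>\<bullet>" "v \<in> carrier B\<^sub>\<bullet>"
  shows "\<exists>p\<in>sigma_pos. u\<lceil>v\<rceil> = u \<otimes>\<^bsub>B\<^sub>\<bullet>\<^esub> p"
proof
  show "\<partial> v \<otimes>\<^bsub>B\<^sub>\<bullet>\<^esub> pbclass [\<sigma> 1] \<otimes>\<^bsub>B\<^sub>\<bullet>\<^esub> \<partial> (inv\<^bsub>B\<^sub>\<bullet>\<^esub> u) \<in> sigma_pos"
    by (intro sigma_pos_shift) simp_all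
  show "u\<lceil>v\<rceil> = u \<otimes>\<^bsub>B\<^sub>\<bullet>\<^esub> (\<partial> v \<otimes>\<^bsub>B\<^sub>\<bullet>\<^esub> pbclass [\<sigma> 1] \<otimes>\<^bsub>B\<^sub>\<bullet>\<^esub> \<partial> (inv\<^bsub>B\<^sub>\<bullet>\<^esub> u))"
    by (simp add: pb_bracket_def PB.m_assoc shift_inv)
qed

text \<open>Each step up the leftmost branch multiplies the value on the right by a positive factor,
  and such factors are closed under products.\<close>

lemma left_subterm_sigma_pos:
  assumes x: "x \<in> carrier B\<^sub>\<bullet>" and "s \<prec> t"
  shows "\<exists>p\<in>sigma_pos. ldeval pb_bracket x t = ldeval pb_bracket x s \<otimes>\<^bsub>B\<^sub>\<bullet>\<^esub> p"
  using assms(2)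
proof induction
  note closed = LD_system.ldeval_closed[OF LD_system_PB x]
  case (left s t)
  show ?case using bracket_sigma_pos[OF closed closed] by simp
next
  note closed = LD_system.ldeval_closed[OF LD_system_PB x]
  case (left_left r s t)
  then obtain p where p: "p \<in> sigma_pos"
    "ldeval pb_bracket x s = ldeval pb_bracket x r \<otimes>\<^bsub>B\<^sub>\<bullet>\<^esub> p" by blast
  obtain q where q: "q \<in> sigma_pos"
    "ldeval pb_bracket x (s \<cdot> t) = ldeval pb_bracket x s \<otimes>\<^bsub>B\<^sub>\<bullet>\<^esub> q"
    using bracket_sigma_pos[OF closed[of s] closed[of t]] by auto
  have "ldeval pb_bracket x (s \<cdot> t) = ldeval pb_bracket x r \<otimes>\<^bsub>B\<^sub>\<bullet>\<^esub> (p \<otimes>\<^bsub>B\<^sub>\<bullet>\<^esub> q)"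
    unfolding q(2) p(2) by (intro PB.m_assoc closed sigma_pos_carrier p(1) q(1))
  with sigma_pos_mult[OF p(1) q(1)] show ?case by blast
qed

theorem corollary4p17:
  fixes x :: "pbgen word set"
  assumes "x \<in> carrier B\<^sub>\<bullet>"
  shows "free_LD_system TYPE('b) (op_closure pb_bracket {x}) pb_bracket {x}"
proof (rule free_LD_system_singletonI[OF LD_system_PB assms])
  fix s t assume "s \<prec> t"
  then obtain p where p: "p \<in> sigma_pos"
    "ldeval pb_bracket x t = ldeval pb_bracket x s \<otimes>\<^bsub>B\<^sub>\<bullet>\<^esub> p"
    using left_subterm_sigma_pos[OF assms] by blast
  have "ldeval pb_bracket x s \<in> carrier B\<^sub>\<bullet>"
    by (rule LD_system.ldeval_closed[OF LD_system_PB assms])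
  \<comment> \<open>Equal values would make the positive factor \<open>p\<close> trivial by left
    cancellation.\<close>
  then have "ldeval pb_bracket x s \<otimes>\<^bsub>B\<^sub>\<bullet>\<^esub> p = ldeval pb_bracket x s \<longleftrightarrow> p = \<one>\<^bsub>B\<^sub>\<bullet>\<^esub>"
    by (rule PB.l_cancel_one[OF _ sigma_pos_carrier[OF p(1)]])
  then show "ldeval pb_bracket x s \<noteq> ldeval pb_bracket x t"
    using p one_notin_sigma_pos by metis
qed

end
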